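(* Let $k$ be a field, let $B=kQ/I$ be a bound quiver algebra, let $F$ be a set of new arrows with no relative cycles, and let $B_F=kQ_F/\langle I\rangle_{kQ_F}$. Let $X$ be a $B_F$-bimodule. Then there is a short exact sequence $$0\to H^1(B_F|B,X)\xrightarrow{\ \iota\ } H^1(B_F,X)\xrightarrow{\ \kappa\ } H^1(B,X)\to 0.$$
   Context: A quiver $Q$ has a finite set of vertices $Q_0$, a finite set of arrows $Q_1$, and source and target maps $s,t:Q_1\to Q_0$. A path of length $n>0$ is a sequence of arrows $(a_n,\dots,a_1)$ with $s(a_{i+1})=t(a_i)$; its source is $s(a_1)$ and its target is $t(a_n)$; vertices are the paths of length $0$. $Q_n$ is the set of paths of length $n$. In the path algebra $kQ$ the product $\beta\alpha$ of two paths is their concatenation if $t(\alpha)=s(\beta)$, and $0$ otherwise; vertices are orthogonal idempotents. A bound quiver algebra is $B=kQ/I$ with $I$ a two-sided ideal which is admissible, i.e. $\langle Q_n\rangle\subset I\subset\langle Q_2\rangle$ for some $n\ge 2$. A set of new arrows is a finite set $F$ with two maps $s,t:F\to Q_0$. The quiver $Q_F$ has vertices $Q_0$ and arrows $Q_1\sqcup F$, with the evident source and target maps; $\langle I\rangle_{kQ_F}$ is the two-sided ideal of $kQ_F$ generated by $I$. The algebra $B$ is a subalgebra of $B_F$ via the canonical map. A relative path of length $n>0$ is a sequence $\gamma=(a_n,\dots,a_1)$ of elements of $F$ such that $s(a_{i+1})\,B\,t(a_i)\neq 0$ for $i=1,\dots,n-1$; put $s(\gamma)=s(a_1)$, $t(\gamma)=t(a_n)$.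 A relative cycle is a relative path $\gamma$ with $s(\gamma)\,B\,t(\gamma)\neq 0$. $H^n(A,X)$ denotes Hochschild cohomology of an algebra $A$ with coefficients in a bimodule $X$; $H^1(A,X)$ is the quotient of the space of $k$-derivations $A\to X$ by the inner derivations $a\mapsto xa-ax$, $x\in X$. For an inclusion $B\subset A$, the relative Hochschild cohomology is $H^n(A|B,X)=\mathrm{Ext}^n_{A\otimes A^{op}|B\otimes B^{op}}(A,X)$ (relative Ext of G. Hochschild). In degree one, $H^1(A|B,X)$ is the quotient of the space of derivations $A\to X$ which are morphisms of $B$-bimodules by the inner derivations $a\mapsto xa-ax$ with $x\in X^B=\{x\in X\mid bx=xb\ \text{for all } b\in B\}$. The map $\iota$ is induced by viewing a relative derivation as a derivation, and $\kappa$ is induced by restricting a derivation to $B$. *)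

theory Defs
  imports "HOL-Algebra.Module" "HOL-Algebra.QuotRing" "Graph_Theory.Arc_Walk"
begin

section \<open>Quivers and path algebras\<close>

text \<open>
  A quiver is a finite directed multigraph, \<^term>\<open>fin_digraph Q\<close>, with source map
  \<^term>\<open>tail Q\<close> and target map \<^term>\<open>head Q\<close>. A path is a pair \<open>(u, p)\<close> of its source and an arc walk
  starting there; the source is needed to tell the paths of length zero, i.e. the vertices, apart.
  Arc walks list the arrows in the order of traversal, so the path written
  \<open>(a_n, \<dots>, a_1)\<close> in the composition order is \<open>(s(a_1), [a_1, \<dots>, a_n])\<close>.
\<close>

type_synonym ('v, 'a) path = "'v \<times> 'a list"

definition paths :: "('v, 'a) pre_digraph \<Rightarrow> ('v, 'a) path set" where
  "paths Q = {(u, p). \<exists>v. pre_digraph.awalk Q u p v}"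

definition path_source :: "('v, 'a) path \<Rightarrow> 'v" where
  "path_source \<alpha> = fst \<alpha>"

definition path_target :: "('v, 'a) pre_digraph \<Rightarrow> ('v, 'a) path \<Rightarrow> 'v" where
  "path_target Q \<alpha> = pre_digraph.awlast Q (fst \<alpha>) (snd \<alpha>)"

definition path_length :: "('v, 'a) path \<Rightarrow> nat" where
  "path_length \<alpha> = length (snd \<alpha>)"

text \<open>\<open>path_comp \<beta> \<alpha>\<close> is \<open>\<beta>\<alpha>\<close>, i.e. first \<open>\<alpha>\<close>, then \<open>\<beta>\<close>.\<close>

definition path_comp :: "('v, 'a) path \<Rightarrow> ('v, 'a) path \<Rightarrow> ('v, 'a) path" where
  "path_comp \<beta> \<alpha> = (fst \<alpha>, snd \<alpha> @ snd \<beta>)"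

text \<open>
  Elements of the path algebra are the finitely supported coefficient functions on paths,
  extended by zero to all pairs of a vertex and a list.
\<close>

definition path_algebra ::
  "('k, 'm) ring_scheme \<Rightarrow> ('v, 'a) pre_digraph \<Rightarrow> ('k, ('v, 'a) path \<Rightarrow> 'k) module" where
  "path_algebra K Q =
    \<lparr>carrier = {f. (\<forall>\<gamma>. f \<gamma> \<in> carrier K) \<and> (\<forall>\<gamma>. \<gamma> \<notin> paths Q \<longrightarrow> f \<gamma> = \<zero>\<^bsub>K\<^esub>) \<and> finite {\<gamma>. f \<gamma> \<noteq> \<zero>\<^bsub>K\<^esub>}},
     mult = (\<lambda>f g \<gamma>. finsum K (\<lambda>(\<beta>, \<alpha>). f \<beta> \<otimes>\<^bsub>K\<^esub> g \<alpha>)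
               {(\<beta>, \<alpha>). \<beta> \<in> paths Q \<and> \<alpha> \<in> paths Q \<and> path_target Q \<alpha> = path_source \<beta> \<and> path_comp \<beta> \<alpha> = \<gamma>}),
     one = (\<lambda>\<gamma>. if \<gamma> \<in> paths Q \<and> path_length \<gamma> = 0 then \<one>\<^bsub>K\<^esub> else \<zero>\<^bsub>K\<^esub>),
     zero = (\<lambda>_. \<zero>\<^bsub>K\<^esub>),
     add = (\<lambda>f g \<gamma>. f \<gamma> \<oplus>\<^bsub>K\<^esub> g \<gamma>),
     smult = (\<lambda>c f \<gamma>. c \<otimes>\<^bsub>K\<^esub> f \<gamma>)\<rparr>"

definition path_elem :: "('k, 'm) ring_scheme \<Rightarrow> ('v, 'a) path \<Rightarrow> ('v, 'a) path \<Rightarrow> 'k" where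
  "path_elem K \<gamma> = (\<lambda>\<delta>. if \<delta> = \<gamma> then \<one>\<^bsub>K\<^esub> else \<zero>\<^bsub>K\<^esub>)"

definition paths_of_length :: "('v, 'a) pre_digraph \<Rightarrow> nat \<Rightarrow> ('v, 'a) path set" where
  "paths_of_length Q n = {\<gamma> \<in> paths Q. path_length \<gamma> = n}"

definition admissible_ideal ::
  "('k, 'm) ring_scheme \<Rightarrow> ('v, 'a) pre_digraph \<Rightarrow> (('v, 'a) path \<Rightarrow> 'k) set \<Rightarrow> bool" where
  "admissible_ideal K Q I \<longleftrightarrow> ideal I (path_algebra K Q) \<and>
    (\<exists>n\<ge>2. Idl\<^bsub>path_algebra K Q\<^esub> (path_elem K ` paths_of_length Q n) \<subseteq> I) \<and>
    I \<subseteq> Idl\<^bsub>path_algebra K Q\<^esub> (path_elem K ` paths_of_length Q 2)"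

section \<open>Quotients\<close>

text \<open>
  The map induced by \<open>h\<close> into the quotient of \<open>M\<close> by \<open>N\<close>, applied to a coset \<open>C\<close>. If the images of
  the elements of \<open>C\<close> are not all congruent modulo \<open>N\<close>, the value is not a coset.
\<close>

definition coset_map :: "('b, 'm) ring_scheme \<Rightarrow> 'b set \<Rightarrow> ('a \<Rightarrow> 'b) \<Rightarrow> 'a set \<Rightarrow> 'b set" where
  "coset_map M N h C = (\<Union>x\<in>C. N +>\<^bsub>M\<^esub> h x)"

text \<open>
  \<^const>\<open>FactRing\<close> together with the scalar action. This serves both for the quotient of an algebra by
  an ideal and for the quotient of a module by a submodule; in the latter case the fields \<open>mult\<close>
  and \<open>one\<close> carry no information.
\<close>

definition quotient :: "('k, 'b, 'm) module_scheme \<Rightarrow> 'b set \<Rightarrow> ('k, 'b set) module" where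
  "quotient M N = ring.extend (M Quot N)
     (module.fields (\<lambda>c. coset_map M N (\<lambda>x. c \<odot>\<^bsub>M\<^esub> x)))"

definition bound_quiver_algebra ::
  "('k, 'm) ring_scheme \<Rightarrow> ('v, 'a) pre_digraph \<Rightarrow> (('v, 'a) path \<Rightarrow> 'k) set \<Rightarrow>
   ('k, (('v, 'a) path \<Rightarrow> 'k) set) module" where
  "bound_quiver_algebra K Q I = quotient (path_algebra K Q) I"

section \<open>New arrows\<close>

locale new_arrows =
  fixes Q :: "('v, 'a) pre_digraph" and F :: "'f set" and s t :: "'f \<Rightarrow> 'v"
  assumes finite_F: "finite F"
    and s_closed: "s \<in> F \<rightarrow> verts Q"
    and t_closed: "t \<in> F \<rightarrow> verts Q"

definition quiver_F ::
  "('v, 'a) pre_digraph \<Rightarrow> 'f set \<Rightarrow> ('f \<Rightarrow> 'v) \<Rightarrow> ('f \<Rightarrow> 'v) \<Rightarrow> ('v, 'a + 'f) pre_digraph" where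
  "quiver_F Q F s t = \<lparr>verts = verts Q, arcs = arcs Q <+> F,
     tail = case_sum (tail Q) s, head = case_sum (head Q) t\<rparr>"

text \<open>The inclusion of \<open>kQ\<close> into \<open>kQ\<^sub>F\<close>: extension by zero.\<close>

definition path_algebra_incl ::
  "('k, 'm) ring_scheme \<Rightarrow> (('v, 'a) path \<Rightarrow> 'k) \<Rightarrow> ('v, 'a + 'f) path \<Rightarrow> 'k" where
  "path_algebra_incl K f = (\<lambda>(u, q). if set q \<subseteq> range Inl then f (u, map projl q) else \<zero>\<^bsub>K\<^esub>)"

definition ideal_F ::
  "('k, 'm) ring_scheme \<Rightarrow> ('v, 'a) pre_digraph \<Rightarrow> (('v, 'a) path \<Rightarrow> 'k) set \<Rightarrow>
   'f set \<Rightarrow> ('f \<Rightarrow> 'v) \<Rightarrow> ('f \<Rightarrow> 'v) \<Rightarrow> (('v, 'a + 'f) path \<Rightarrow> 'k) set" where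
  "ideal_F K Q I F s t = Idl\<^bsub>path_algebra K (quiver_F Q F s t)\<^esub> (path_algebra_incl K ` I)"

definition algebra_F ::
  "('k, 'm) ring_scheme \<Rightarrow> ('v, 'a) pre_digraph \<Rightarrow> (('v, 'a) path \<Rightarrow> 'k) set \<Rightarrow>
   'f set \<Rightarrow> ('f \<Rightarrow> 'v) \<Rightarrow> ('f \<Rightarrow> 'v) \<Rightarrow> ('k, (('v, 'a + 'f) path \<Rightarrow> 'k) set) module" where
  "algebra_F K Q I F s t = quotient (path_algebra K (quiver_F Q F s t)) (ideal_F K Q I F s t)"

text \<open>The canonical map from \<open>B\<close> to \<open>B\<^sub>F\<close>.\<close>

definition canonical_map ::
  "('k, 'm) ring_scheme \<Rightarrow> ('v, 'a) pre_digraph \<Rightarrow> (('v, 'a) path \<Rightarrow> 'k) set \<Rightarrow>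
   'f set \<Rightarrow> ('f \<Rightarrow> 'v) \<Rightarrow> ('f \<Rightarrow> 'v) \<Rightarrow>
   (('v, 'a) path \<Rightarrow> 'k) set \<Rightarrow> (('v, 'a + 'f) path \<Rightarrow> 'k) set" where
  "canonical_map K Q I F s t =
     coset_map (path_algebra K (quiver_F Q F s t)) (ideal_F K Q I F s t) (path_algebra_incl K)"

definition idem ::
  "('k, 'm) ring_scheme \<Rightarrow> ('v, 'a) pre_digraph \<Rightarrow> (('v, 'a) path \<Rightarrow> 'k) set \<Rightarrow> 'v \<Rightarrow>
   (('v, 'a) path \<Rightarrow> 'k) set" where
  "idem K Q I v = I +>\<^bsub>path_algebra K Q\<^esub> path_elem K (v, [])"

text \<open>\<open>u B v \<noteq> 0\<close> for vertices \<open>u\<close> and \<open>v\<close>.\<close>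

definition peirce_nonzero ::
  "('k, 'm) ring_scheme \<Rightarrow> ('v, 'a) pre_digraph \<Rightarrow> (('v, 'a) path \<Rightarrow> 'k) set \<Rightarrow> 'v \<Rightarrow> 'v \<Rightarrow> bool" where
  "peirce_nonzero K Q I u v \<longleftrightarrow> (let B = bound_quiver_algebra K Q I in
     \<exists>b\<in>carrier B. idem K Q I u \<otimes>\<^bsub>B\<^esub> b \<otimes>\<^bsub>B\<^esub> idem K Q I v \<noteq> \<zero>\<^bsub>B\<^esub>)"

text \<open>
  As for paths, the list \<open>[a_1, \<dots>, a_n]\<close> stands for the relative path \<open>(a_n, \<dots>, a_1)\<close>, so its source
  is that of the head of the list.
\<close>

definition relative_path ::
  "('k, 'm) ring_scheme \<Rightarrow> ('v, 'a) pre_digraph \<Rightarrow> (('v, 'a) path \<Rightarrow> 'k) set \<Rightarrow>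
   'f set \<Rightarrow> ('f \<Rightarrow> 'v) \<Rightarrow> ('f \<Rightarrow> 'v) \<Rightarrow> 'f list \<Rightarrow> bool" where
  "relative_path K Q I F s t \<gamma> \<longleftrightarrow> \<gamma> \<noteq> [] \<and> set \<gamma> \<subseteq> F \<and>
     successively (\<lambda>a a'. peirce_nonzero K Q I (s a') (t a)) \<gamma>"

definition relative_cycle ::
  "('k, 'm) ring_scheme \<Rightarrow> ('v, 'a) pre_digraph \<Rightarrow> (('v, 'a) path \<Rightarrow> 'k) set \<Rightarrow>
   'f set \<Rightarrow> ('f \<Rightarrow> 'v) \<Rightarrow> ('f \<Rightarrow> 'v) \<Rightarrow> 'f list \<Rightarrow> bool" where
  "relative_cycle K Q I F s t \<gamma> \<longleftrightarrow> relative_path K Q I F s t \<gamma> \<and>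
     peirce_nonzero K Q I (s (hd \<gamma>)) (t (last \<gamma>))"

section \<open>Bimodules and Hochschild cohomology in degree one\<close>

text \<open>
  A unital bimodule over the \<open>K\<close>-algebra \<open>A\<close> on which \<open>K\<close> acts centrally; the fields \<open>mult\<close> and \<open>one\<close>
  of \<open>X\<close> are not used.
\<close>

locale bimodule = K: field K + A: ring A + X: Module.module K X
  for K :: "('k, 'm) ring_scheme" and A :: "('k, 'b, 'n) module_scheme"
    and X :: "('k, 'x, 'p) module_scheme" +
  fixes l :: "'b \<Rightarrow> 'x \<Rightarrow> 'x" and r :: "'x \<Rightarrow> 'b \<Rightarrow> 'x"
  assumes l_closed: "\<lbrakk>a \<in> carrier A; x \<in> carrier X\<rbrakk> \<Longrightarrow> l a x \<in> carrier X"
    and r_closed: "\<lbrakk>a \<in> carrier A; x \<in> carrier X\<rbrakk> \<Longrightarrow> r x a \<in> carrier X"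
    and l_add: "\<lbrakk>a \<in> carrier A; a' \<in> carrier A; x \<in> carrier X\<rbrakk> \<Longrightarrow>
          l (a \<oplus>\<^bsub>A\<^esub> a') x = l a x \<oplus>\<^bsub>X\<^esub> l a' x"
    and r_add: "\<lbrakk>a \<in> carrier A; a' \<in> carrier A; x \<in> carrier X\<rbrakk> \<Longrightarrow>
          r x (a \<oplus>\<^bsub>A\<^esub> a') = r x a \<oplus>\<^bsub>X\<^esub> r x a'"
    and l_distr: "\<lbrakk>a \<in> carrier A; x \<in> carrier X; y \<in> carrier X\<rbrakk> \<Longrightarrow>
          l a (x \<oplus>\<^bsub>X\<^esub> y) = l a x \<oplus>\<^bsub>X\<^esub> l a y"
    and r_distr: "\<lbrakk>a \<in> carrier A; x \<in> carrier X; y \<in> carrier X\<rbrakk> \<Longrightarrow>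
          r (x \<oplus>\<^bsub>X\<^esub> y) a = r x a \<oplus>\<^bsub>X\<^esub> r y a"
    and l_mult: "\<lbrakk>a \<in> carrier A; a' \<in> carrier A; x \<in> carrier X\<rbrakk> \<Longrightarrow> l (a \<otimes>\<^bsub>A\<^esub> a') x = l a (l a' x)"
    and r_mult: "\<lbrakk>a \<in> carrier A; a' \<in> carrier A; x \<in> carrier X\<rbrakk> \<Longrightarrow> r x (a \<otimes>\<^bsub>A\<^esub> a') = r (r x a) a'"
    and l_one: "x \<in> carrier X \<Longrightarrow> l \<one>\<^bsub>A\<^esub> x = x"
    and r_one: "x \<in> carrier X \<Longrightarrow> r x \<one>\<^bsub>A\<^esub> = x"
    and l_r: "\<lbrakk>a \<in> carrier A; a' \<in> carrier A; x \<in> carrier X\<rbrakk> \<Longrightarrow> r (l a x) a' = l a (r x a')"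
    and l_smult: "\<lbrakk>c \<in> carrier K; a \<in> carrier A; x \<in> carrier X\<rbrakk> \<Longrightarrow>
          l (c \<odot>\<^bsub>A\<^esub> a) x = c \<odot>\<^bsub>X\<^esub> l a x"
    and r_smult: "\<lbrakk>c \<in> carrier K; a \<in> carrier A; x \<in> carrier X\<rbrakk> \<Longrightarrow>
          r x (c \<odot>\<^bsub>A\<^esub> a) = c \<odot>\<^bsub>X\<^esub> r x a"

text \<open>Derivations are taken to be undefined outside the carrier, so that equal maps are equal terms.\<close>

definition derivations ::
  "('k, 'm) ring_scheme \<Rightarrow> ('k, 'b, 'n) module_scheme \<Rightarrow> ('k, 'x, 'p) module_scheme \<Rightarrow>
   ('b \<Rightarrow> 'x \<Rightarrow> 'x) \<Rightarrow> ('x \<Rightarrow> 'b \<Rightarrow> 'x) \<Rightarrow> ('b \<Rightarrow> 'x) set" where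
  "derivations K A X l r = {d \<in> carrier A \<rightarrow>\<^sub>E carrier X.
     (\<forall>a\<in>carrier A. \<forall>a'\<in>carrier A. d (a \<oplus>\<^bsub>A\<^esub> a') = d a \<oplus>\<^bsub>X\<^esub> d a') \<and>
     (\<forall>c\<in>carrier K. \<forall>a\<in>carrier A. d (c \<odot>\<^bsub>A\<^esub> a) = c \<odot>\<^bsub>X\<^esub> d a) \<and>
     (\<forall>a\<in>carrier A. \<forall>a'\<in>carrier A. d (a \<otimes>\<^bsub>A\<^esub> a') = r (d a) a' \<oplus>\<^bsub>X\<^esub> l a (d a'))}"

text \<open>Derivations that are morphisms of bimodules over the subalgebra with carrier \<open>S\<close>.\<close>

definition relative_derivations ::
  "('k, 'm) ring_scheme \<Rightarrow> ('k, 'b, 'n) module_scheme \<Rightarrow> 'b set \<Rightarrow> ('k, 'x, 'p) module_scheme \<Rightarrow>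
   ('b \<Rightarrow> 'x \<Rightarrow> 'x) \<Rightarrow> ('x \<Rightarrow> 'b \<Rightarrow> 'x) \<Rightarrow> ('b \<Rightarrow> 'x) set" where
  "relative_derivations K A S X l r = {d \<in> derivations K A X l r.
     \<forall>b\<in>S. \<forall>a\<in>carrier A. d (b \<otimes>\<^bsub>A\<^esub> a) = l b (d a) \<and> d (a \<otimes>\<^bsub>A\<^esub> b) = r (d a) b}"

definition inner_derivation ::
  "('k, 'b, 'n) module_scheme \<Rightarrow> ('k, 'x, 'p) module_scheme \<Rightarrow>
   ('b \<Rightarrow> 'x \<Rightarrow> 'x) \<Rightarrow> ('x \<Rightarrow> 'b \<Rightarrow> 'x) \<Rightarrow> 'x \<Rightarrow> 'b \<Rightarrow> 'x" where
  "inner_derivation A X l r x = (\<lambda>a\<in>carrier A. r x a \<ominus>\<^bsub>X\<^esub> l a x)"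

definition invariants ::
  "'b set \<Rightarrow> ('k, 'x, 'p) module_scheme \<Rightarrow> ('b \<Rightarrow> 'x \<Rightarrow> 'x) \<Rightarrow> ('x \<Rightarrow> 'b \<Rightarrow> 'x) \<Rightarrow> 'x set" where
  "invariants S X l r = {x \<in> carrier X. \<forall>b\<in>S. l b x = r x b}"

text \<open>A space of functions with pointwise operations; again \<open>mult\<close> and \<open>one\<close> are not used.\<close>

definition fun_module ::
  "('k, 'b, 'n) module_scheme \<Rightarrow> ('k, 'x, 'p) module_scheme \<Rightarrow> ('b \<Rightarrow> 'x) set \<Rightarrow>
   ('k, 'b \<Rightarrow> 'x) module" where
  "fun_module A X D = \<lparr>carrier = D, mult = undefined, one = undefined,
     zero = (\<lambda>a\<in>carrier A. \<zero>\<^bsub>X\<^esub>),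
     add = (\<lambda>d d'. \<lambda>a\<in>carrier A. d a \<oplus>\<^bsub>X\<^esub> d' a),
     smult = (\<lambda>c d. \<lambda>a\<in>carrier A. c \<odot>\<^bsub>X\<^esub> d a)\<rparr>"

definition HH1 ::
  "('k, 'm) ring_scheme \<Rightarrow> ('k, 'b, 'n) module_scheme \<Rightarrow> ('k, 'x, 'p) module_scheme \<Rightarrow>
   ('b \<Rightarrow> 'x \<Rightarrow> 'x) \<Rightarrow> ('x \<Rightarrow> 'b \<Rightarrow> 'x) \<Rightarrow> ('k, ('b \<Rightarrow> 'x) set) module" where
  "HH1 K A X l r = quotient (fun_module A X (derivations K A X l r))
     (inner_derivation A X l r ` carrier X)"

definition relative_HH1 ::
  "('k, 'm) ring_scheme \<Rightarrow> ('k, 'b, 'n) module_scheme \<Rightarrow> 'b set \<Rightarrow> ('k, 'x, 'p) module_scheme \<Rightarrow>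
   ('b \<Rightarrow> 'x \<Rightarrow> 'x) \<Rightarrow> ('x \<Rightarrow> 'b \<Rightarrow> 'x) \<Rightarrow> ('k, ('b \<Rightarrow> 'x) set) module" where
  "relative_HH1 K A S X l r = quotient (fun_module A X (relative_derivations K A S X l r))
     (inner_derivation A X l r ` invariants S X l r)"

text \<open>The map on \<open>H\<^sup>1\<close> induced by viewing a relative derivation as a derivation.\<close>

definition iota ::
  "('k, 'm) ring_scheme \<Rightarrow> ('k, 'b, 'n) module_scheme \<Rightarrow> ('k, 'x, 'p) module_scheme \<Rightarrow>
   ('b \<Rightarrow> 'x \<Rightarrow> 'x) \<Rightarrow> ('x \<Rightarrow> 'b \<Rightarrow> 'x) \<Rightarrow> ('b \<Rightarrow> 'x) set \<Rightarrow> ('b \<Rightarrow> 'x) set" where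
  "iota K A X l r = coset_map (fun_module A X (derivations K A X l r))
     (inner_derivation A X l r ` carrier X) (\<lambda>d. d)"

text \<open>
  For a bimodule over the codomain of \<open>j\<close>, the actions restricted along \<open>j\<close>, and the map on \<open>H\<^sup>1\<close>
  induced by \<open>d \<mapsto> d \<circ> j\<close>.
\<close>

definition res_l :: "('c \<Rightarrow> 'b) \<Rightarrow> ('b \<Rightarrow> 'x \<Rightarrow> 'x) \<Rightarrow> 'c \<Rightarrow> 'x \<Rightarrow> 'x" where
  "res_l j l = (\<lambda>b x. l (j b) x)"

definition res_r :: "('c \<Rightarrow> 'b) \<Rightarrow> ('x \<Rightarrow> 'b \<Rightarrow> 'x) \<Rightarrow> 'x \<Rightarrow> 'c \<Rightarrow> 'x" where
  "res_r j r = (\<lambda>x b. r x (j b))"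

definition kappa ::
  "('k, 'm) ring_scheme \<Rightarrow> ('k, 'c, 'n) module_scheme \<Rightarrow> ('c \<Rightarrow> 'b) \<Rightarrow> ('k, 'x, 'p) module_scheme \<Rightarrow>
   ('b \<Rightarrow> 'x \<Rightarrow> 'x) \<Rightarrow> ('x \<Rightarrow> 'b \<Rightarrow> 'x) \<Rightarrow> ('b \<Rightarrow> 'x) set \<Rightarrow> ('c \<Rightarrow> 'x) set" where
  "kappa K B j X l r =
     coset_map (fun_module B X (derivations K B X (res_l j l) (res_r j r)))
       (inner_derivation B X (res_l j l) (res_r j r) ` carrier X)
       (\<lambda>d. \<lambda>b\<in>carrier B. d (j b))"

section \<open>Short exact sequences\<close>

definition linear_maps ::
  "('k, 'm) ring_scheme \<Rightarrow> ('k, 'b, 'n) module_scheme \<Rightarrow> ('k, 'c, 'p) module_scheme \<Rightarrow> ('b \<Rightarrow> 'c) set" where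
  "linear_maps K M N = {h \<in> carrier M \<rightarrow> carrier N.
     (\<forall>x\<in>carrier M. \<forall>y\<in>carrier M. h (x \<oplus>\<^bsub>M\<^esub> y) = h x \<oplus>\<^bsub>N\<^esub> h y) \<and>
     (\<forall>c\<in>carrier K. \<forall>x\<in>carrier M. h (c \<odot>\<^bsub>M\<^esub> x) = c \<odot>\<^bsub>N\<^esub> h x)}"

text \<open>
  \<open>0 \<rightarrow> L \<rightarrow> M \<rightarrow> N \<rightarrow> 0\<close> with maps \<open>f\<close> and \<open>g\<close>. The library's \<open>exact_seq\<close> requires all the
  groups to have the same element type.
\<close>

definition short_exact ::
  "('k, 'm) ring_scheme \<Rightarrow> ('k, 'a, 'n) module_scheme \<Rightarrow> ('k, 'b, 'p) module_scheme \<Rightarrow>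
   ('k, 'c, 'q) module_scheme \<Rightarrow> ('a \<Rightarrow> 'b) \<Rightarrow> ('b \<Rightarrow> 'c) \<Rightarrow> bool" where
  "short_exact K L M N f g \<longleftrightarrow>
     Module.module K L \<and> Module.module K M \<and> Module.module K N \<and>
     f \<in> linear_maps K L M \<and> g \<in> linear_maps K M N \<and>
     inj_on f (carrier L) \<and>
     f ` carrier L = a_kernel M N g \<and>
     g ` carrier M = carrier N"

end

theory Submission
  imports Defs
begin

text \<open>
  Let \<open>A\<close> be an algebra with a subalgebra \<open>B\<close>. A derivation of \<open>A\<close> is a morphism of \<open>B\<close>-bimodules exactly
  if it vanishes on \<open>B\<close>: one direction is the Leibniz rule, the other one is \<open>d b = b d(1) = 0\<close>
  (\<open>relative_derivations_eq\<close>). This makes the left part of the sequence formal. A relative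
  derivation that is the commutator with some \<open>x\<close> vanishes on \<open>B\<close>, so \<open>x\<close> is \<open>B\<close>-invariant and \<open>\<iota>\<close> is
  injective. A derivation of \<open>A\<close> whose restriction to \<open>B\<close> is the commutator with \<open>x\<close> differs from the
  inner derivation of \<open>x\<close> by a derivation that vanishes on \<open>B\<close>, so the kernel of \<open>\<kappa>\<close> is the image of
  \<open>\<iota>\<close>. What is left is the surjectivity of \<open>\<kappa>\<close>, and for this it suffices that every derivation of \<open>B\<close>
  extends to \<open>A\<close> (\<open>short_exact_if_derivations_extend\<close>).

  For \<open>A = B\<^sub>F\<close> the extension exists because the arrows in \<open>F\<close> are adjoined freely: the only relations
  on a new arrow \<open>f\<close> from \<open>u\<close> to \<open>v\<close> are \<open>f = e\<^sub>v f = f e\<^sub>u\<close>. Given a derivation \<open>d\<close> of \<open>B\<close>, the assignment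
  \<open>f \<mapsto> d(e\<^sub>v) f + f d(e\<^sub>u)\<close> is compatible with these two relations, since \<open>e d(e) e = 0\<close> for every
  idempotent \<open>e\<close> (\<open>head_tail_of_arrow_value\<close>). On the path algebra \<open>kQ\<^sub>F\<close>, which is free on its
  arrows over its vertices, values on vertices and arrows that respect the relations
  \<open>e\<^sub>u e\<^sub>v = \<delta>\<^sub>u\<^sub>v e\<^sub>u\<close> and \<open>a = e a = a e'\<close> come from a derivation (\<open>ex_derivation\<close>), so \<open>d\<close> and the
  assignment above define a derivation \<open>\<delta>\<close> of \<open>kQ\<^sub>F\<close> with values in \<open>X\<close>. On \<open>kQ\<close> it agrees with \<open>d\<close>
  composed with the projection \<open>kQ \<rightarrow> B\<close>, because both are derivations with the same values on
  vertices and arrows. Hence \<open>\<delta>\<close> vanishes on \<open>I\<close>, and then on the ideal that \<open>I\<close> generates in \<open>kQ\<^sub>F\<close>,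
  because that ideal acts by zero on \<open>X\<close>. So \<open>\<delta>\<close> induces the required derivation of \<open>B\<^sub>F\<close>
  (\<open>derivation_extends\<close>).
\<close>

section \<open>Quotients of modules and short exact sequences\<close>

context abelian_group
begin

lemma minus_telescope:
  "\<lbrakk>x \<in> carrier G; y \<in> carrier G; z \<in> carrier G\<rbrakk> \<Longrightarrow> (x \<ominus> y) \<oplus> (y \<ominus> z) = x \<ominus> z"
  by (simp add: minus_eq a_assoc r_neg1)

lemma add_minus_add:
  "\<lbrakk>x \<in> carrier G; y \<in> carrier G; x' \<in> carrier G; y' \<in> carrier G\<rbrakk> \<Longrightarrow>
    (x \<oplus> y) \<ominus> (x' \<oplus> y') = (x \<ominus> x') \<oplus> (y \<ominus> y')"
  by (simp add: minus_eq minus_add a_ac)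

lemma minus_eq_zero_iff: "\<lbrakk>x \<in> carrier G; y \<in> carrier G\<rbrakk> \<Longrightarrow> x \<ominus> y = \<zero> \<longleftrightarrow> x = y"
  by (metis a_inv_closed minus_equality minus_minus minus_eq r_neg)

end

lemma quotient_simps:
  "carrier (quotient M N) = a_rcosets\<^bsub>M\<^esub> N"
  "mult (quotient M N) = rcoset_mult M N"
  "one (quotient M N) = N +>\<^bsub>M\<^esub> \<one>\<^bsub>M\<^esub>"
  "zero (quotient M N) = N"
  "add (quotient M N) = set_add M"
  "smult (quotient M N) c = coset_map M N (smult M c)"
  by (simp_all add: quotient_def FactRing_def ring.defs module.defs)

locale submodule_of = Module.module K M
  for K :: "('k, 'm) ring_scheme" and M :: "('k, 'b, 'n) module_scheme" (structure) +
  fixes N :: "'b set"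
  assumes submodule: "submodule N K M"
begin

lemma abelian_subgroup: "abelian_subgroup N M"
  using submodule by (intro abelian_subgroupI3 additive_subgroupI M.abelian_group_axioms)
    (simp add: submodule_def)

sublocale N: abelian_subgroup N M
  by (rule abelian_subgroup)

lemma smult_mem: "\<lbrakk>c \<in> carrier K; x \<in> N\<rbrakk> \<Longrightarrow> c \<odot> x \<in> N"
  using submodule submodule.smult_closed by metis

lemma coset_eq_iff:
  "\<lbrakk>x \<in> carrier M; y \<in> carrier M\<rbrakk> \<Longrightarrow> N +> x = N +> y \<longleftrightarrow> x \<ominus> y \<in> N"
  by (metis N.a_rcos_module N.a_rcos_self N.a_repr_independence' M.minus_eq)

lemma coset_eq_submodule_iff: "x \<in> carrier M \<Longrightarrow> N +> x = N \<longleftrightarrow> x \<in> N"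
  by (metis N.a_rcos_self N.a_rcos_const)

lemma carrier_quotient_image: "carrier (quotient M N) = (\<lambda>x. N +> x) ` carrier M"
  by (auto simp: quotient_simps A_RCOSETS_def')

lemma cosetE:
  assumes "C \<in> carrier (quotient M N)"
  obtains x where "x \<in> carrier M" "C = N +> x"
  using assms by (auto simp: carrier_quotient_image)

lemma coset_mem [simp]: "x \<in> carrier M \<Longrightarrow> N +> x \<in> carrier (quotient M N)"
  by (auto simp: carrier_quotient_image)

lemma zero_quotient: "\<zero>\<^bsub>quotient M N\<^esub> = N +> \<zero>"
  using coset_eq_submodule_iff[of \<zero>] by (simp add: quotient_simps)

lemma coset_add [simp]:
  "\<lbrakk>x \<in> carrier M; y \<in> carrier M\<rbrakk> \<Longrightarrow> (N +> x) \<oplus>\<^bsub>quotient M N\<^esub> (N +> y) = N +> (x \<oplus> y)"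
  by (simp add: quotient_simps N.a_rcos_sum)

end

lemma submodule_ofI:
  assumes "Module.module K M" "N \<subseteq> carrier M" "\<zero>\<^bsub>M\<^esub> \<in> N"
    and "\<And>x y. \<lbrakk>x \<in> N; y \<in> N\<rbrakk> \<Longrightarrow> x \<oplus>\<^bsub>M\<^esub> y \<in> N"
    and "\<And>c x. \<lbrakk>c \<in> carrier K; x \<in> N\<rbrakk> \<Longrightarrow> c \<odot>\<^bsub>M\<^esub> x \<in> N"
  shows "submodule_of K M N"
proof -
  interpret Module.module K M by fact
  have "\<ominus>\<^bsub>M\<^esub> x \<in> N" if "x \<in> N" for x
  proof -
    \<comment> \<open>negatives are multiples by \<open>-1\<close>\<close>
    have "\<ominus>\<^bsub>M\<^esub> x = (\<ominus>\<^bsub>K\<^esub> \<one>\<^bsub>K\<^esub>) \<odot>\<^bsub>M\<^esub> x"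
      using assms(2) that by (simp add: smult_l_minus subsetD)
    then show ?thesis using assms(5) that by simp
  qed
  then show ?thesis
    by (intro submodule_of.intro submodule_of_axioms.intro module_axioms submoduleI assms)
qed

locale linear_map = M: Module.module K M + M': Module.module K M'
  for K :: "('k, 'm) ring_scheme" and M :: "('k, 'b, 'n) module_scheme"
    and M' :: "('k, 'c, 'p) module_scheme" +
  fixes h :: "'b \<Rightarrow> 'c"
  assumes linear: "h \<in> linear_maps K M M'"
begin

lemma closed [simp, intro]: "x \<in> carrier M \<Longrightarrow> h x \<in> carrier M'"
  using linear by (auto simp: linear_maps_def)

lemma add [simp]: "\<lbrakk>x \<in> carrier M; y \<in> carrier M\<rbrakk> \<Longrightarrow> h (x \<oplus>\<^bsub>M\<^esub> y) = h x \<oplus>\<^bsub>M'\<^esub> h y"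
  using linear by (auto simp: linear_maps_def)

lemma smult [simp]: "\<lbrakk>c \<in> carrier K; x \<in> carrier M\<rbrakk> \<Longrightarrow> h (c \<odot>\<^bsub>M\<^esub> x) = c \<odot>\<^bsub>M'\<^esub> h x"
  using linear by (auto simp: linear_maps_def)

lemma zero [simp]: "h \<zero>\<^bsub>M\<^esub> = \<zero>\<^bsub>M'\<^esub>"
  using smult[of "\<zero>\<^bsub>K\<^esub>" "\<zero>\<^bsub>M\<^esub>"] by simp

lemma minus [simp]: "\<lbrakk>x \<in> carrier M; y \<in> carrier M\<rbrakk> \<Longrightarrow> h (x \<ominus>\<^bsub>M\<^esub> y) = h x \<ominus>\<^bsub>M'\<^esub> h y"
proof -
  assume xy: "x \<in> carrier M" "y \<in> carrier M"
  have "h (\<ominus>\<^bsub>M\<^esub> y) = \<ominus>\<^bsub>M'\<^esub> h y"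
    using add[of "\<ominus>\<^bsub>M\<^esub> y" y] xy by (intro M'.M.minus_equality[symmetric]) (simp_all add: M.M.l_neg)
  then show ?thesis using xy by (simp add: M.M.minus_eq M'.M.minus_eq)
qed

end

lemma linear_mapI:
  assumes "Module.module K M" "Module.module K M'"
    and "\<And>x. x \<in> carrier M \<Longrightarrow> h x \<in> carrier M'"
    and "\<And>x y. \<lbrakk>x \<in> carrier M; y \<in> carrier M\<rbrakk> \<Longrightarrow> h (x \<oplus>\<^bsub>M\<^esub> y) = h x \<oplus>\<^bsub>M'\<^esub> h y"
    and "\<And>c x. \<lbrakk>c \<in> carrier K; x \<in> carrier M\<rbrakk> \<Longrightarrow> h (c \<odot>\<^bsub>M\<^esub> x) = c \<odot>\<^bsub>M'\<^esub> h x"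
  shows "linear_map K M M' h"
  using assms by (simp add: linear_map_def linear_map_axioms_def linear_maps_def)

text \<open>
  The situation in which \<^const>\<open>coset_map\<close> is well defined: elements of a coset of \<open>N\<close> differ by elements
  of \<open>N\<close>, so their images under \<open>h\<close> differ by elements of \<open>N'\<close> and all terms of the union in the
  definition of \<^const>\<open>coset_map\<close> are the same coset.
\<close>

locale linear_map_mod = linear_map K M M' h + N: submodule_of K M N + N': submodule_of K M' N'
  for K :: "('k, 'm) ring_scheme" and M :: "('k, 'b, 'n) module_scheme"
    and M' :: "('k, 'c, 'p) module_scheme" and h N N' +
  assumes maps_submodule: "x \<in> N \<Longrightarrow> h x \<in> N'"
begin

lemma coset_map_coset [simp]:
  assumes "x \<in> carrier M"
  shows "coset_map M' N' h (N +>\<^bsub>M\<^esub> x) = N' +>\<^bsub>M'\<^esub> h x"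
proof -
  have "N' +>\<^bsub>M'\<^esub> h y = N' +>\<^bsub>M'\<^esub> h x" if "y \<in> N +>\<^bsub>M\<^esub> x" for y
  proof -
    have y: "y \<in> carrier M" using that assms N.N.a_elemrcos_carrier by blast
    have "N +>\<^bsub>M\<^esub> y = N +>\<^bsub>M\<^esub> x"
      using that assms N.N.a_repr_independence' by metis
    then have "y \<ominus>\<^bsub>M\<^esub> x \<in> N" using assms y N.coset_eq_iff by blast
    then have "h y \<ominus>\<^bsub>M'\<^esub> h x \<in> N'" using maps_submodule assms y by force
    then show ?thesis using assms y N'.coset_eq_iff by simp
  qed
  moreover have "x \<in> N +>\<^bsub>M\<^esub> x" using assms N.N.a_rcos_self by blast
  ultimately show ?thesis
    unfolding coset_map_def by (intro UN_constant_eq ballI)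
qed

end

text \<open>Scalar multiplication on a quotient is itself a \<^const>\<open>coset_map\<close>.\<close>

context submodule_of
begin

lemma linear_map_mod_smult: "c \<in> carrier K \<Longrightarrow> linear_map_mod K M M (\<lambda>x. c \<odot> x) N N"
proof (intro linear_map_mod.intro linear_mapI linear_map_mod_axioms.intro module_axioms submodule_of_axioms)
  fix d x assume "c \<in> carrier K" "d \<in> carrier K" "x \<in> carrier M"
  then show "c \<odot> (d \<odot> x) = d \<odot> (c \<odot> x)"
    by (simp add: R.m_comm flip: smult_assoc1)
qed (simp_all add: smult_mem smult_r_distr)

lemma coset_smult [simp]:
  "\<lbrakk>c \<in> carrier K; x \<in> carrier M\<rbrakk> \<Longrightarrow> c \<odot>\<^bsub>quotient M N\<^esub> (N +> x) = N +> (c \<odot> x)"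
  by (simp add: quotient_simps linear_map_mod.coset_map_coset[OF linear_map_mod_smult])

lemma module_quotient: "Module.module K (quotient M N)"
proof (rule moduleI)
  let ?Q = "quotient M N"
  show "cring K" by (rule R.cring_axioms)
  show "abelian_group ?Q"
  proof (rule abelian_groupI)
    fix C assume "C \<in> carrier ?Q"
    then obtain x where x: "x \<in> carrier M" "C = N +> x" by (rule cosetE)
    then show "\<zero>\<^bsub>?Q\<^esub> \<oplus>\<^bsub>?Q\<^esub> C = C" by (simp add: zero_quotient)
    show "\<exists>D\<in>carrier ?Q. D \<oplus>\<^bsub>?Q\<^esub> C = \<zero>\<^bsub>?Q\<^esub>"
      using x by (intro bexI[of _ "N +> (\<ominus> x)"]) (simp_all add: zero_quotient M.l_neg)
    fix D assume "D \<in> carrier ?Q"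
    then obtain y where y: "y \<in> carrier M" "D = N +> y" by (rule cosetE)
    show "C \<oplus>\<^bsub>?Q\<^esub> D \<in> carrier ?Q" "C \<oplus>\<^bsub>?Q\<^esub> D = D \<oplus>\<^bsub>?Q\<^esub> C"
      using x y by (simp_all add: M.a_comm)
    fix E assume "E \<in> carrier ?Q"
    then obtain z where z: "z \<in> carrier M" "E = N +> z" by (rule cosetE)
    show "(C \<oplus>\<^bsub>?Q\<^esub> D) \<oplus>\<^bsub>?Q\<^esub> E = C \<oplus>\<^bsub>?Q\<^esub> (D \<oplus>\<^bsub>?Q\<^esub> E)"
      using x y z by (simp add: M.a_assoc)
  qed (simp add: zero_quotient)
next
  let ?Q = "quotient M N"
  fix C assume "C \<in> carrier ?Q"
  then obtain x where x: "x \<in> carrier M" "C = N +> x" by (rule cosetE)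
  then show "\<one>\<^bsub>K\<^esub> \<odot>\<^bsub>?Q\<^esub> C = C" by simp
  fix c assume c: "c \<in> carrier K"
  then show "c \<odot>\<^bsub>?Q\<^esub> C \<in> carrier ?Q" using x by simp
  fix d assume d: "d \<in> carrier K"
  show "(c \<oplus>\<^bsub>K\<^esub> d) \<odot>\<^bsub>?Q\<^esub> C = c \<odot>\<^bsub>?Q\<^esub> C \<oplus>\<^bsub>?Q\<^esub> d \<odot>\<^bsub>?Q\<^esub> C"
    "(c \<otimes>\<^bsub>K\<^esub> d) \<odot>\<^bsub>?Q\<^esub> C = c \<odot>\<^bsub>?Q\<^esub> (d \<odot>\<^bsub>?Q\<^esub> C)"
    using c d x by (simp_all add: smult_l_distr smult_assoc1)
next
  let ?Q = "quotient M N"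
  fix c C D assume c: "c \<in> carrier K" and "C \<in> carrier ?Q" "D \<in> carrier ?Q"
  then obtain x y where "x \<in> carrier M" "C = N +> x" "y \<in> carrier M" "D = N +> y"
    by (auto elim!: cosetE)
  then show "c \<odot>\<^bsub>?Q\<^esub> (C \<oplus>\<^bsub>?Q\<^esub> D) = c \<odot>\<^bsub>?Q\<^esub> C \<oplus>\<^bsub>?Q\<^esub> c \<odot>\<^bsub>?Q\<^esub> D"
    using c by (simp add: smult_r_distr)
qed

end

lemma (in linear_map_mod) linear_map_quotient:
  "linear_map K (quotient M N) (quotient M' N') (coset_map M' N' h)"
proof (rule linear_mapI[OF N.module_quotient N'.module_quotient])
  fix C assume "C \<in> carrier (quotient M N)"
  then obtain x where x: "x \<in> carrier M" "C = N +>\<^bsub>M\<^esub> x" by (rule N.cosetE)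
  then show "coset_map M' N' h C \<in> carrier (quotient M' N')" by simp
  show "coset_map M' N' h (c \<odot>\<^bsub>quotient M N\<^esub> C) = c \<odot>\<^bsub>quotient M' N'\<^esub> coset_map M' N' h C"
    if "c \<in> carrier K" for c using that x by simp
  fix D assume "D \<in> carrier (quotient M N)"
  then obtain y where "y \<in> carrier M" "D = N +>\<^bsub>M\<^esub> y" by (rule N.cosetE)
  then show "coset_map M' N' h (C \<oplus>\<^bsub>quotient M N\<^esub> D) =
      coset_map M' N' h C \<oplus>\<^bsub>quotient M' N'\<^esub> coset_map M' N' h D"
    using x by simp
qed

text \<open>The homomorphism theorem, for maps into an arbitrary module.\<close>

lemma (in submodule_of) ex_linear_map_quotient:
  assumes "linear_map K M X h" and vanish: "\<And>x. x \<in> N \<Longrightarrow> h x = \<zero>\<^bsub>X\<^esub>"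
  shows "\<exists>h'. linear_map K (quotient M N) X h' \<and> (\<forall>x\<in>carrier M. h' (N +> x) = h x)"
proof -
  interpret h: linear_map K M X h by fact
  define h' where "h' C = h (SOME x. x \<in> carrier M \<and> C = N +> x)" for C
  have h': "h' (N +> x) = h x" if x: "x \<in> carrier M" for x
  proof -
    define y where "y = (SOME y. y \<in> carrier M \<and> N +> x = N +> y)"
    have "y \<in> carrier M \<and> N +> x = N +> y"
      unfolding y_def using x by (intro someI[of "\<lambda>y. y \<in> carrier M \<and> N +> x = N +> y" x]) simp
    then have y: "y \<in> carrier M" "x \<ominus> y \<in> N" using x coset_eq_iff by blast+
    then have "h x \<ominus>\<^bsub>X\<^esub> h y = \<zero>\<^bsub>X\<^esub>" using x vanish[of "x \<ominus> y"] by simp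
    then have "h y = h x" using x y by (simp add: h.M'.M.minus_eq_zero_iff)
    then show ?thesis by (simp add: h'_def flip: y_def)
  qed
  have "linear_map K (quotient M N) X h'"
  proof (intro linear_mapI module_quotient h.M'.module_axioms)
    fix C assume "C \<in> carrier (quotient M N)"
    then obtain x where x: "x \<in> carrier M" "C = N +> x" by (rule cosetE)
    then show "h' C \<in> carrier X" by (simp add: h')
    show "h' (c \<odot>\<^bsub>quotient M N\<^esub> C) = c \<odot>\<^bsub>X\<^esub> h' C" if "c \<in> carrier K" for c
      using x that by (simp add: h')
    fix D assume "D \<in> carrier (quotient M N)"
    then obtain y where "y \<in> carrier M" "D = N +> y" by (rule cosetE)
    then show "h' (C \<oplus>\<^bsub>quotient M N\<^esub> D) = h' C \<oplus>\<^bsub>X\<^esub> h' D" using x by (simp add: h')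
  qed
  then show ?thesis using h' by blast
qed

text \<open>
  All three groups of the sequence are quotients of modules of derivations by modules of inner
  derivations. This reduces exactness to statements about representatives, one for each of
  injectivity, exactness in the middle and surjectivity.
\<close>

lemma short_exact_quotients:
  assumes f: "linear_map K L M f" and g: "linear_map K M N g"
    and L': "submodule_of K L L'" and M': "submodule_of K M M'" and N': "submodule_of K N N'"
    and inj: "\<And>x. x \<in> carrier L \<Longrightarrow> f x \<in> M' \<longleftrightarrow> x \<in> L'"
    and exact: "\<And>y. y \<in> carrier M \<Longrightarrow> g y \<in> N' \<longleftrightarrow> (\<exists>x\<in>carrier L. \<exists>m\<in>M'. y = m \<oplus>\<^bsub>M\<^esub> f x)"
    and surj: "\<And>z. z \<in> carrier N \<Longrightarrow> \<exists>y\<in>carrier M. z = g y"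
  shows "short_exact K (quotient L L') (quotient M M') (quotient N N')
    (coset_map M M' f) (coset_map N N' g)"
proof -
  interpret f: linear_map K L M f by fact
  interpret g: linear_map K M N g by fact
  interpret L': submodule_of K L L' by fact
  interpret M': submodule_of K M M' by fact
  interpret N': submodule_of K N N' by fact
  interpret f': linear_map_mod K L M f L' M'
    using inj L'.N.a_Hcarr by unfold_locales blast
  have "g m \<in> N'" if "m \<in> M'" for m
    using that exact[of m] f.zero f.M.M.zero_closed f.M'.M.r_zero M'.N.a_Hcarr by metis
  then interpret g': linear_map_mod K M N g M' N'
    by unfold_locales
  let ?f = "coset_map M M' f" and ?g = "coset_map N N' g"
  have "inj_on ?f (carrier (quotient L L'))"
  proof (rule inj_onI)
    fix C D assume "C \<in> carrier (quotient L L')" "D \<in> carrier (quotient L L')" and eq: "?f C = ?f D"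
    then obtain x y where "x \<in> carrier L" "C = L' +>\<^bsub>L\<^esub> x" "y \<in> carrier L" "D = L' +>\<^bsub>L\<^esub> y"
      by (elim L'.cosetE)
    with eq inj[of "x \<ominus>\<^bsub>L\<^esub> y"] show "C = D"
      by (simp add: M'.coset_eq_iff L'.coset_eq_iff)
  qed
  moreover have "?f ` carrier (quotient L L') = a_kernel (quotient M M') (quotient N N') ?g"
  proof -
    have image_iff: "(M' +>\<^bsub>M\<^esub> y \<in> ?f ` carrier (quotient L L')) \<longleftrightarrow> g y \<in> N'" if y: "y \<in> carrier M" for y
    proof -
      have "M' +>\<^bsub>M\<^esub> y \<in> ?f ` carrier (quotient L L') \<longleftrightarrow>
          (\<exists>x\<in>carrier L. M' +>\<^bsub>M\<^esub> y = M' +>\<^bsub>M\<^esub> f x)"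
        by (simp add: L'.carrier_quotient_image image_image Set.image_iff)
      also have "\<dots> \<longleftrightarrow> (\<exists>x\<in>carrier L. \<exists>m\<in>M'. y = m \<oplus>\<^bsub>M\<^esub> f x)"
      proof (intro bex_cong refl)
        fix x assume x: "x \<in> carrier L"
        have "y = (y \<ominus>\<^bsub>M\<^esub> f x) \<oplus>\<^bsub>M\<^esub> f x"
          using x y by (simp add: f.M'.M.minus_eq f.M'.M.a_assoc f.M'.M.l_neg)
        moreover have "(m \<oplus>\<^bsub>M\<^esub> f x) \<ominus>\<^bsub>M\<^esub> f x = m" if "m \<in> M'" for m
          using x M'.N.a_Hcarr[OF that] by (simp add: f.M'.M.minus_eq f.M'.M.a_assoc f.M'.M.r_neg)
        ultimately show "M' +>\<^bsub>M\<^esub> y = M' +>\<^bsub>M\<^esub> f x \<longleftrightarrow> (\<exists>m\<in>M'. y = m \<oplus>\<^bsub>M\<^esub> f x)"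
          using x y by (auto simp: M'.coset_eq_iff)
      qed
      finally show ?thesis using exact y by blast
    qed
    have image_subset: "?f ` carrier (quotient L L') \<subseteq> carrier (quotient M M')"
      by (auto simp: L'.carrier_quotient_image)
    have kernel_iff: "M' +>\<^bsub>M\<^esub> y \<in> a_kernel (quotient M M') (quotient N N') ?g \<longleftrightarrow> g y \<in> N'"
      if "y \<in> carrier M" for y
      using that by (simp add: a_kernel_def' quotient_simps(4) N'.coset_eq_submodule_iff)
    have kernel_subset: "a_kernel (quotient M M') (quotient N N') ?g \<subseteq> carrier (quotient M M')"
      by (simp add: a_kernel_def')
    show ?thesis
    proof (rule Set.set_eqI)
      fix C
      show "C \<in> ?f ` carrier (quotient L L') \<longleftrightarrow> C \<in> a_kernel (quotient M M') (quotient N N') ?g"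
      proof (cases "C \<in> carrier (quotient M M')")
        case True
        then obtain y where y: "y \<in> carrier M" and C: "C = M' +>\<^bsub>M\<^esub> y" by (rule M'.cosetE)
        show ?thesis unfolding C using image_iff[OF y] kernel_iff[OF y] by (simp only:)
      qed (use image_subset kernel_subset in blast)
    qed
  qed
  moreover have "?g ` carrier (quotient M M') = carrier (quotient N N')"
  proof -
    have "carrier N = g ` carrier M" using surj by auto
    then show ?thesis by (simp add: M'.carrier_quotient_image N'.carrier_quotient_image image_image)
  qed
  ultimately show ?thesis
    using f'.linear_map_quotient g'.linear_map_quotient L'.module_quotient M'.module_quotient
      N'.module_quotient
    by (simp add: short_exact_def linear_map_def linear_map_axioms_def)
qed

section \<open>Algebras, ideals and bimodules\<close>

text \<open>
  The locale \<^locale>\<open>algebra\<close> is about commutative algebras; here the multiplication is arbitrary and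
  has to be linear in both arguments.
\<close>

locale unital_algebra = Module.module K A + ring A
  for K :: "('k, 'm) ring_scheme" and A :: "('k, 'b, 'n) module_scheme" (structure) +
  assumes smult_mult_l: "\<lbrakk>c \<in> carrier K; a \<in> carrier A; b \<in> carrier A\<rbrakk> \<Longrightarrow>
      (c \<odot> a) \<otimes> b = c \<odot> (a \<otimes> b)"
    and smult_mult_r: "\<lbrakk>c \<in> carrier K; a \<in> carrier A; b \<in> carrier A\<rbrakk> \<Longrightarrow>
      a \<otimes> (c \<odot> b) = c \<odot> (a \<otimes> b)"

locale algebra_hom = A: unital_algebra K A + B: unital_algebra K B + linear_map K A B h
  for K :: "('k, 'm) ring_scheme" and A :: "('k, 'a, 'n) module_scheme"
    and B :: "('k, 'b, 'p) module_scheme" and h +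
  assumes mult [simp]: "\<lbrakk>x \<in> carrier A; y \<in> carrier A\<rbrakk> \<Longrightarrow> h (x \<otimes>\<^bsub>A\<^esub> y) = h x \<otimes>\<^bsub>B\<^esub> h y"
    and one [simp]: "h \<one>\<^bsub>A\<^esub> = \<one>\<^bsub>B\<^esub>"

locale algebra_ideal = unital_algebra K A + ideal I A
  for K :: "('k, 'm) ring_scheme" and A :: "('k, 'b, 'n) module_scheme" (structure) and I
begin

sublocale submodule_of K A I
proof (rule submodule_ofI)
  fix c x assume c: "c \<in> carrier K" and x: "x \<in> I"
  \<comment> \<open>an ideal absorbs scalars because they act through multiples of the unit\<close>
  have "c \<odot> x = (c \<odot> \<one>) \<otimes> x" using c x by (simp add: smult_mult_l)
  then show "c \<odot> x \<in> I" using c x by (simp add: I_l_closed)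
qed (simp_all add: module_axioms a_subset)

lemma coset_mult [simp]:
  "\<lbrakk>x \<in> carrier A; y \<in> carrier A\<rbrakk> \<Longrightarrow> (I +> x) \<otimes>\<^bsub>quotient A I\<^esub> (I +> y) = I +> (x \<otimes> y)"
  by (simp add: quotient_simps rcoset_mult_add)

lemma quotient_one: "\<one>\<^bsub>quotient A I\<^esub> = I +> \<one>"
  by (simp add: quotient_simps)

lemma unital_algebra_quotient: "unital_algebra K (quotient A I)"
proof -
  interpret Q: Module.module K "quotient A I" by (rule module_quotient)
  let ?Q = "quotient A I"
  have "ring ?Q"
  proof (rule ringI)
    show "abelian_group ?Q" by (rule Q.M.abelian_group_axioms)
    show "Group.monoid ?Q"
    proof (rule monoidI)
      fix C assume "C \<in> carrier ?Q"
      then obtain x where x: "x \<in> carrier A" "C = I +> x" by (rule cosetE)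
      then show "\<one>\<^bsub>?Q\<^esub> \<otimes>\<^bsub>?Q\<^esub> C = C" "C \<otimes>\<^bsub>?Q\<^esub> \<one>\<^bsub>?Q\<^esub> = C" by (simp_all add: quotient_one)
      fix D assume "D \<in> carrier ?Q"
      then obtain y where y: "y \<in> carrier A" "D = I +> y" by (rule cosetE)
      then show "C \<otimes>\<^bsub>?Q\<^esub> D \<in> carrier ?Q" using x by simp
      fix E assume "E \<in> carrier ?Q"
      then obtain z where "z \<in> carrier A" "E = I +> z" by (rule cosetE)
      then show "(C \<otimes>\<^bsub>?Q\<^esub> D) \<otimes>\<^bsub>?Q\<^esub> E = C \<otimes>\<^bsub>?Q\<^esub> (D \<otimes>\<^bsub>?Q\<^esub> E)" using x y by (simp add: m_assoc)
    qed (simp add: quotient_one)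
    fix C D E assume "C \<in> carrier ?Q" "D \<in> carrier ?Q" "E \<in> carrier ?Q"
    then obtain x y z where "x \<in> carrier A" "C = I +> x" "y \<in> carrier A" "D = I +> y"
      "z \<in> carrier A" "E = I +> z" by (elim cosetE)
    then show "(C \<oplus>\<^bsub>?Q\<^esub> D) \<otimes>\<^bsub>?Q\<^esub> E = C \<otimes>\<^bsub>?Q\<^esub> E \<oplus>\<^bsub>?Q\<^esub> D \<otimes>\<^bsub>?Q\<^esub> E"
      "E \<otimes>\<^bsub>?Q\<^esub> (C \<oplus>\<^bsub>?Q\<^esub> D) = E \<otimes>\<^bsub>?Q\<^esub> C \<oplus>\<^bsub>?Q\<^esub> E \<otimes>\<^bsub>?Q\<^esub> D"
      by (simp_all add: l_distr r_distr)
  qed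
  then show ?thesis
  proof (intro unital_algebra.intro unital_algebra_axioms.intro module_quotient)
    fix c C D assume c: "c \<in> carrier K" and "C \<in> carrier ?Q" "D \<in> carrier ?Q"
    then obtain x y where "x \<in> carrier A" "C = I +> x" "y \<in> carrier A" "D = I +> y"
      by (elim cosetE)
    then show "(c \<odot>\<^bsub>?Q\<^esub> C) \<otimes>\<^bsub>?Q\<^esub> D = c \<odot>\<^bsub>?Q\<^esub> (C \<otimes>\<^bsub>?Q\<^esub> D)"
      "C \<otimes>\<^bsub>?Q\<^esub> (c \<odot>\<^bsub>?Q\<^esub> D) = c \<odot>\<^bsub>?Q\<^esub> (C \<otimes>\<^bsub>?Q\<^esub> D)"
      using c by (simp_all add: smult_mult_l smult_mult_r)
  qed
qed

lemma algebra_hom_coset: "algebra_hom K A (quotient A I) (\<lambda>x. I +> x)"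
  by (intro algebra_hom.intro algebra_hom_axioms.intro linear_mapI unital_algebra_axioms
      unital_algebra_quotient module_axioms module_quotient) (simp_all add: quotient_one)

end

lemma algebra_hom_coset_map:
  assumes "algebra_hom K A A' h" and "ideal I A" and "ideal I' A'" and "h ` I \<subseteq> I'"
  shows "algebra_hom K (quotient A I) (quotient A' I') (coset_map A' I' h)"
    and "x \<in> carrier A \<Longrightarrow> coset_map A' I' h (I +>\<^bsub>A\<^esub> x) = I' +>\<^bsub>A'\<^esub> h x"
proof -
  interpret h: algebra_hom K A A' h by fact
  interpret I: algebra_ideal K A I
    by (intro algebra_ideal.intro h.A.unital_algebra_axioms assms)
  interpret I': algebra_ideal K A' I'
    by (intro algebra_ideal.intro h.B.unital_algebra_axioms assms)
  interpret hh: linear_map_mod K A A' h I I'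
    using assms(4) by unfold_locales blast
  show "x \<in> carrier A \<Longrightarrow> coset_map A' I' h (I +>\<^bsub>A\<^esub> x) = I' +>\<^bsub>A'\<^esub> h x"
    by (rule hh.coset_map_coset)
  show "algebra_hom K (quotient A I) (quotient A' I') (coset_map A' I' h)"
  proof (intro algebra_hom.intro algebra_hom_axioms.intro hh.linear_map_quotient
      I.unital_algebra_quotient I'.unital_algebra_quotient)
    fix C D assume "C \<in> carrier (quotient A I)" "D \<in> carrier (quotient A I)"
    then obtain x y where "x \<in> carrier A" "C = I +>\<^bsub>A\<^esub> x" "y \<in> carrier A" "D = I +>\<^bsub>A\<^esub> y"
      by (elim I.cosetE)
    then show "coset_map A' I' h (C \<otimes>\<^bsub>quotient A I\<^esub> D) =
        coset_map A' I' h C \<otimes>\<^bsub>quotient A' I'\<^esub> coset_map A' I' h D"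
      by simp
  qed (simp add: I.quotient_one I'.quotient_one)
qed

lemma bimodule_restrict:
  assumes "bimodule K A X l r" and "algebra_hom K B A h"
  shows "bimodule K B X (res_l h l) (res_r h r)"
proof -
  interpret bimodule K A X l r by fact
  interpret h: algebra_hom K B A h by fact
  show ?thesis
    by (intro bimodule.intro bimodule_axioms.intro K.field_axioms h.A.ring_axioms X.module_axioms)
      (simp_all add: res_l_def res_r_def l_closed r_closed l_add r_add l_distr r_distr l_mult r_mult
        l_one r_one l_r l_smult r_smult)
qed

section \<open>Derivations and the exact sequence of a subalgebra\<close>

locale algebra_bimodule = bimodule K A X l r + A: unital_algebra K A
  for K :: "('k, 'm) ring_scheme" and A :: "('k, 'b, 'n) module_scheme"
    and X :: "('k, 'x, 'p) module_scheme" and l r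
begin

lemmas [simp] = l_closed r_closed

text \<open>
  Linearity of the actions in the argument from \<open>X\<close> is not among the axioms of a bimodule. It follows
  because \<open>c\<close> acts on \<open>X\<close> like the central element \<open>c 1\<close> of \<open>A\<close>.
\<close>

lemma l_smult_right: "\<lbrakk>c \<in> carrier K; a \<in> carrier A; x \<in> carrier X\<rbrakk> \<Longrightarrow> l a (c \<odot>\<^bsub>X\<^esub> x) = c \<odot>\<^bsub>X\<^esub> l a x"
  using l_mult[of a "c \<odot>\<^bsub>A\<^esub> \<one>\<^bsub>A\<^esub>" x] by (simp add: A.smult_mult_r l_smult l_one)

lemma r_smult_left: "\<lbrakk>c \<in> carrier K; a \<in> carrier A; x \<in> carrier X\<rbrakk> \<Longrightarrow> r (c \<odot>\<^bsub>X\<^esub> x) a = c \<odot>\<^bsub>X\<^esub> r x a"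
  using r_mult[of "c \<odot>\<^bsub>A\<^esub> \<one>\<^bsub>A\<^esub>" a x] by (simp add: A.smult_mult_l r_smult r_one)

lemma linear_map_l_right: "a \<in> carrier A \<Longrightarrow> linear_map K X X (\<lambda>x. l a x)"
  by (intro linear_mapI X.module_axioms) (simp_all add: l_distr l_smult_right)

lemma linear_map_l_left: "x \<in> carrier X \<Longrightarrow> linear_map K A X (\<lambda>a. l a x)"
  by (intro linear_mapI X.module_axioms A.module_axioms) (simp_all add: l_add l_smult)

lemma linear_map_r_left: "a \<in> carrier A \<Longrightarrow> linear_map K X X (\<lambda>x. r x a)"
  by (intro linear_mapI X.module_axioms) (simp_all add: r_distr r_smult_left)

lemma linear_map_r_right: "x \<in> carrier X \<Longrightarrow> linear_map K A X (\<lambda>a. r x a)"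
  by (intro linear_mapI X.module_axioms A.module_axioms) (simp_all add: r_add r_smult)

lemma action_zero [simp]:
  "a \<in> carrier A \<Longrightarrow> l a \<zero>\<^bsub>X\<^esub> = \<zero>\<^bsub>X\<^esub>" "x \<in> carrier X \<Longrightarrow> l \<zero>\<^bsub>A\<^esub> x = \<zero>\<^bsub>X\<^esub>"
  "a \<in> carrier A \<Longrightarrow> r \<zero>\<^bsub>X\<^esub> a = \<zero>\<^bsub>X\<^esub>" "x \<in> carrier X \<Longrightarrow> r x \<zero>\<^bsub>A\<^esub> = \<zero>\<^bsub>X\<^esub>"
  by (simp_all add: linear_map.zero[OF linear_map_l_right] linear_map.zero[OF linear_map_l_left]
      linear_map.zero[OF linear_map_r_left] linear_map.zero[OF linear_map_r_right])

lemma linear_map_derivation: "d \<in> derivations K A X l r \<Longrightarrow> linear_map K A X d"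
  by (intro linear_mapI X.module_axioms A.module_axioms) (auto simp: derivations_def)

lemma derivation_mult:
  "\<lbrakk>d \<in> derivations K A X l r; a \<in> carrier A; b \<in> carrier A\<rbrakk> \<Longrightarrow>
    d (a \<otimes>\<^bsub>A\<^esub> b) = r (d a) b \<oplus>\<^bsub>X\<^esub> l a (d b)"
  by (simp add: derivations_def)

lemma derivationI:
  assumes "linear_map K A X d"
    and "\<And>a b. \<lbrakk>a \<in> carrier A; b \<in> carrier A\<rbrakk> \<Longrightarrow> d (a \<otimes>\<^bsub>A\<^esub> b) = r (d a) b \<oplus>\<^bsub>X\<^esub> l a (d b)"
  shows "restrict d (carrier A) \<in> derivations K A X l r"
proof -
  interpret linear_map K A X d by fact
  show ?thesis using assms(2) by (simp add: derivations_def)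
qed

lemma derivation_one:
  assumes "d \<in> derivations K A X l r"
  shows "d \<one>\<^bsub>A\<^esub> = \<zero>\<^bsub>X\<^esub>"
proof -
  interpret d: linear_map K A X d using assms by (rule linear_map_derivation)
  have "d \<one>\<^bsub>A\<^esub> = d \<one>\<^bsub>A\<^esub> \<oplus>\<^bsub>X\<^esub> d \<one>\<^bsub>A\<^esub>"
    using derivation_mult[OF assms, of "\<one>\<^bsub>A\<^esub>" "\<one>\<^bsub>A\<^esub>"] by (simp add: l_one r_one)
  then show ?thesis by simp
qed

text \<open>
  If \<open>d\<close> commutes with the actions of \<open>S\<close>, then \<open>d b = b d(1) = 0\<close> for \<open>b\<close> in \<open>S\<close>. If \<open>d\<close> vanishes on \<open>S\<close>, then
  one of the two terms of the Leibniz rule for \<open>b a\<close> and for \<open>a b\<close> vanishes.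
\<close>

lemma relative_derivations_eq:
  assumes "S \<subseteq> carrier A"
  shows "relative_derivations K A S X l r = {d \<in> derivations K A X l r. \<forall>b\<in>S. d b = \<zero>\<^bsub>X\<^esub>}"
  unfolding relative_derivations_def
proof (intro Collect_cong conj_cong refl ballI iffI)
  fix d b assume d: "d \<in> derivations K A X l r" and b: "b \<in> S"
    and rel: "\<forall>b\<in>S. \<forall>a\<in>carrier A. d (b \<otimes>\<^bsub>A\<^esub> a) = l b (d a) \<and> d (a \<otimes>\<^bsub>A\<^esub> b) = r (d a) b"
  have "d (b \<otimes>\<^bsub>A\<^esub> \<one>\<^bsub>A\<^esub>) = l b (d \<one>\<^bsub>A\<^esub>)" using rel b by blast
  then show "d b = \<zero>\<^bsub>X\<^esub>" using assms b derivation_one[OF d] by auto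
next
  fix d b a assume d: "d \<in> derivations K A X l r" and b: "b \<in> S" and a: "a \<in> carrier A"
    and zero: "\<forall>b\<in>S. d b = \<zero>\<^bsub>X\<^esub>"
  interpret d: linear_map K A X d using d by (rule linear_map_derivation)
  have "b \<in> carrier A" "d b = \<zero>\<^bsub>X\<^esub>" using assms b zero by auto
  then show "d (b \<otimes>\<^bsub>A\<^esub> a) = l b (d a) \<and> d (a \<otimes>\<^bsub>A\<^esub> b) = r (d a) b"
    using a derivation_mult[OF d] by simp
qed

lemma inner_derivation_apply:
  "a \<in> carrier A \<Longrightarrow> inner_derivation A X l r x a = r x a \<ominus>\<^bsub>X\<^esub> l a x"
  by (simp add: inner_derivation_def)

lemma inner_derivation_mem:
  assumes x: "x \<in> carrier X"
  shows "inner_derivation A X l r x \<in> derivations K A X l r"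
  unfolding inner_derivation_def
proof (intro derivationI linear_mapI X.module_axioms A.module_axioms)
  fix a assume a: "a \<in> carrier A"
  then show "r x a \<ominus>\<^bsub>X\<^esub> l a x \<in> carrier X" using x by simp
  show "r x (c \<odot>\<^bsub>A\<^esub> a) \<ominus>\<^bsub>X\<^esub> l (c \<odot>\<^bsub>A\<^esub> a) x = c \<odot>\<^bsub>X\<^esub> (r x a \<ominus>\<^bsub>X\<^esub> l a x)" if "c \<in> carrier K" for c
    using x a that by (simp add: X.M.minus_eq X.smult_r_distr X.smult_r_minus r_smult l_smult)
  fix b assume b: "b \<in> carrier A"
  show "r x (a \<oplus>\<^bsub>A\<^esub> b) \<ominus>\<^bsub>X\<^esub> l (a \<oplus>\<^bsub>A\<^esub> b) x =
      (r x a \<ominus>\<^bsub>X\<^esub> l a x) \<oplus>\<^bsub>X\<^esub> (r x b \<ominus>\<^bsub>X\<^esub> l b x)"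
    using x a b by (simp add: r_add l_add X.M.add_minus_add)
  interpret l: linear_map K X X "\<lambda>x. l a x" using a by (rule linear_map_l_right)
  interpret r: linear_map K X X "\<lambda>x. r x b" using b by (rule linear_map_r_left)
  show "r x (a \<otimes>\<^bsub>A\<^esub> b) \<ominus>\<^bsub>X\<^esub> l (a \<otimes>\<^bsub>A\<^esub> b) x =
      r (r x a \<ominus>\<^bsub>X\<^esub> l a x) b \<oplus>\<^bsub>X\<^esub> l a (r x b \<ominus>\<^bsub>X\<^esub> l b x)"
    using x a b by (simp add: r_mult l_mult l_r X.M.minus_telescope)
qed

lemma inner_derivation_eq_zero_iff:
  assumes "S \<subseteq> carrier A" "x \<in> carrier X"
  shows "(\<forall>b\<in>S. inner_derivation A X l r x b = \<zero>\<^bsub>X\<^esub>) \<longleftrightarrow> x \<in> invariants S X l r"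
proof -
  have "inner_derivation A X l r x b = \<zero>\<^bsub>X\<^esub> \<longleftrightarrow> l b x = r x b" if "b \<in> S" for b
  proof -
    have "b \<in> carrier A" using assms(1) that by blast
    then show ?thesis
      using assms(2) by (auto simp: inner_derivation_apply X.M.minus_eq_zero_iff)
  qed
  then show ?thesis using assms(2) by (simp add: invariants_def)
qed

text \<open>
  For \<open>S = {}\<close> these are all derivations, and \<^term>\<open>invariants {} X l r\<close> is all of \<open>X\<close>. The absolute and the
  relative cohomology are thus two instances of one construction.
\<close>

definition vanishing_derivations :: "'b set \<Rightarrow> ('b \<Rightarrow> 'x) set" where
  "vanishing_derivations S = {d \<in> derivations K A X l r. \<forall>b\<in>S. d b = \<zero>\<^bsub>X\<^esub>}"

lemma fun_module_simps:
  "carrier (fun_module A X D) = D"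
  "zero (fun_module A X D) = (\<lambda>a\<in>carrier A. \<zero>\<^bsub>X\<^esub>)"
  "add (fun_module A X D) = (\<lambda>d d'. \<lambda>a\<in>carrier A. d a \<oplus>\<^bsub>X\<^esub> d' a)"
  "smult (fun_module A X D) = (\<lambda>c d. \<lambda>a\<in>carrier A. c \<odot>\<^bsub>X\<^esub> d a)"
  by (simp_all add: fun_module_def)

lemma module_fun_module:
  assumes D: "D \<subseteq> carrier A \<rightarrow>\<^sub>E carrier X"
    and zero: "(\<lambda>a\<in>carrier A. \<zero>\<^bsub>X\<^esub>) \<in> D"
    and add: "\<And>d d'. \<lbrakk>d \<in> D; d' \<in> D\<rbrakk> \<Longrightarrow> (\<lambda>a\<in>carrier A. d a \<oplus>\<^bsub>X\<^esub> d' a) \<in> D"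
    and smult: "\<And>c d. \<lbrakk>c \<in> carrier K; d \<in> D\<rbrakk> \<Longrightarrow> (\<lambda>a\<in>carrier A. c \<odot>\<^bsub>X\<^esub> d a) \<in> D"
  shows "Module.module K (fun_module A X D)"
proof -
  have cl: "d a \<in> carrier X" if "d \<in> D" "a \<in> carrier A" for d a
    using D that by auto
  have ext: "(\<lambda>a\<in>carrier A. d a) = d" if "d \<in> D" for d
    using D that by (auto intro: PiE_restrict)
  note facts = cl ext zero add smult X.M.a_ac
    X.smult_l_distr X.smult_r_distr X.smult_assoc1
  show ?thesis
  proof (intro moduleI abelian_groupI, unfold fun_module_simps)
    fix d assume d: "d \<in> D"
    show "\<exists>d'\<in>D. (\<lambda>a\<in>carrier A. d' a \<oplus>\<^bsub>X\<^esub> d a) = (\<lambda>a\<in>carrier A. \<zero>\<^bsub>X\<^esub>)"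
    proof (intro bexI restrict_ext)
      show "(\<lambda>a\<in>carrier A. (\<ominus>\<^bsub>K\<^esub> \<one>\<^bsub>K\<^esub>) \<odot>\<^bsub>X\<^esub> d a) \<in> D" using smult d by simp
    qed (use d in \<open>simp add: cl X.smult_l_minus X.M.l_neg\<close>)
    show "(\<lambda>a\<in>carrier A. (\<lambda>a\<in>carrier A. \<zero>\<^bsub>X\<^esub>) a \<oplus>\<^bsub>X\<^esub> d a) = d"
      "(\<lambda>a\<in>carrier A. \<one>\<^bsub>K\<^esub> \<odot>\<^bsub>X\<^esub> d a) = d"
      using d by (simp_all add: facts cong: restrict_cong)
  qed (auto simp: facts K.cring_axioms intro!: restrict_ext)
qed

lemma module_derivations:
  assumes "S \<subseteq> carrier A"
  shows "Module.module K (fun_module A X (vanishing_derivations S))"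
proof (rule module_fun_module)
  show "vanishing_derivations S \<subseteq> carrier A \<rightarrow>\<^sub>E carrier X"
    by (auto simp: vanishing_derivations_def derivations_def)
  have zero: "linear_map K A X (\<lambda>a. \<zero>\<^bsub>X\<^esub>)"
    by (intro linear_mapI X.module_axioms A.module_axioms) simp_all
  show "(\<lambda>a\<in>carrier A. \<zero>\<^bsub>X\<^esub>) \<in> vanishing_derivations S"
    using assms derivationI[OF zero] by (auto simp: vanishing_derivations_def)
  fix d assume d: "d \<in> vanishing_derivations S"
  interpret d: linear_map K A X d
    using d by (intro linear_map_derivation) (simp add: vanishing_derivations_def)
  have d_mult: "d (a \<otimes>\<^bsub>A\<^esub> b) = r (d a) b \<oplus>\<^bsub>X\<^esub> l a (d b)" if "a \<in> carrier A" "b \<in> carrier A" for a b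
    using that d derivation_mult by (simp add: vanishing_derivations_def)
  {
    fix c assume c: "c \<in> carrier K"
    have "linear_map K A X (\<lambda>a. c \<odot>\<^bsub>X\<^esub> d a)"
      using c by (intro linear_mapI X.module_axioms A.module_axioms)
        (simp_all add: X.smult_r_distr K.m_comm flip: X.smult_assoc1)
    moreover have "c \<odot>\<^bsub>X\<^esub> d (a \<otimes>\<^bsub>A\<^esub> b) = r (c \<odot>\<^bsub>X\<^esub> d a) b \<oplus>\<^bsub>X\<^esub> l a (c \<odot>\<^bsub>X\<^esub> d b)"
      if "a \<in> carrier A" "b \<in> carrier A" for a b
      using c that by (simp add: d_mult X.smult_r_distr l_smult_right r_smult_left)
    ultimately show "(\<lambda>a\<in>carrier A. c \<odot>\<^bsub>X\<^esub> d a) \<in> vanishing_derivations S"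
      using assms c d derivationI by (auto simp: vanishing_derivations_def)
  }
  fix e assume e: "e \<in> vanishing_derivations S"
  interpret e: linear_map K A X e
    using e by (intro linear_map_derivation) (simp add: vanishing_derivations_def)
  have e_mult: "e (a \<otimes>\<^bsub>A\<^esub> b) = r (e a) b \<oplus>\<^bsub>X\<^esub> l a (e b)" if "a \<in> carrier A" "b \<in> carrier A" for a b
    using that e derivation_mult by (simp add: vanishing_derivations_def)
  have "linear_map K A X (\<lambda>a. d a \<oplus>\<^bsub>X\<^esub> e a)"
    by (intro linear_mapI X.module_axioms A.module_axioms) (simp_all add: X.smult_r_distr X.M.a_ac)
  moreover have "d (a \<otimes>\<^bsub>A\<^esub> b) \<oplus>\<^bsub>X\<^esub> e (a \<otimes>\<^bsub>A\<^esub> b) = r (d a \<oplus>\<^bsub>X\<^esub> e a) b \<oplus>\<^bsub>X\<^esub> l a (d b \<oplus>\<^bsub>X\<^esub> e b)"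
    if "a \<in> carrier A" "b \<in> carrier A" for a b
    using that by (simp add: d_mult e_mult l_distr r_distr X.M.a_ac)
  ultimately show "(\<lambda>a\<in>carrier A. d a \<oplus>\<^bsub>X\<^esub> e a) \<in> vanishing_derivations S"
    using assms d e derivationI[of "\<lambda>a. d a \<oplus>\<^bsub>X\<^esub> e a"] by (auto simp: vanishing_derivations_def)
qed

lemma submodule_inner_derivations:
  assumes S: "S \<subseteq> carrier A"
  shows "submodule_of K (fun_module A X (vanishing_derivations S))
    (inner_derivation A X l r ` invariants S X l r)"
proof (rule submodule_ofI[OF module_derivations[OF S]], unfold fun_module_simps)
  have inv_carrier: "invariants S X l r \<subseteq> carrier X" by (auto simp: invariants_def)
  then show "inner_derivation A X l r ` invariants S X l r \<subseteq> vanishing_derivations S"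
    using inner_derivation_eq_zero_iff[OF S] inner_derivation_mem
    unfolding vanishing_derivations_def by blast
  have SA: "b \<in> carrier A" if "b \<in> S" for b using S that by blast
  have "\<zero>\<^bsub>X\<^esub> \<in> invariants S X l r" by (simp add: invariants_def SA)
  moreover have "inner_derivation A X l r \<zero>\<^bsub>X\<^esub> = (\<lambda>a\<in>carrier A. \<zero>\<^bsub>X\<^esub>)"
    by (auto simp: inner_derivation_def X.M.minus_eq intro!: restrict_ext)
  ultimately show "(\<lambda>a\<in>carrier A. \<zero>\<^bsub>X\<^esub>) \<in> inner_derivation A X l r ` invariants S X l r"
    by (metis imageI)
  fix d assume "d \<in> inner_derivation A X l r ` invariants S X l r"
  then obtain x where d: "d = inner_derivation A X l r x" and x: "x \<in> invariants S X l r" by blast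
  have xX: "x \<in> carrier X" using x inv_carrier by blast
  {
    fix c assume c: "c \<in> carrier K"
    have "c \<odot>\<^bsub>X\<^esub> x \<in> invariants S X l r"
      using c x by (simp add: invariants_def SA l_smult_right r_smult_left)
    moreover have "inner_derivation A X l r (c \<odot>\<^bsub>X\<^esub> x) = (\<lambda>a\<in>carrier A. c \<odot>\<^bsub>X\<^esub> d a)"
      unfolding d inner_derivation_def using c xX
      by (auto simp: l_smult_right r_smult_left X.M.minus_eq X.smult_r_distr X.smult_r_minus
          intro!: restrict_ext)
    ultimately show "(\<lambda>a\<in>carrier A. c \<odot>\<^bsub>X\<^esub> d a) \<in> inner_derivation A X l r ` invariants S X l r"
      by (metis imageI)
  }
  fix e assume "e \<in> inner_derivation A X l r ` invariants S X l r"
  then obtain y where e: "e = inner_derivation A X l r y" and y: "y \<in> invariants S X l r" by blast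
  have yX: "y \<in> carrier X" using y inv_carrier by blast
  have "x \<oplus>\<^bsub>X\<^esub> y \<in> invariants S X l r"
    using x y by (simp add: invariants_def SA l_distr r_distr)
  moreover have "inner_derivation A X l r (x \<oplus>\<^bsub>X\<^esub> y) = (\<lambda>a\<in>carrier A. d a \<oplus>\<^bsub>X\<^esub> e a)"
    unfolding d e inner_derivation_def using xX yX
    by (auto simp: l_distr r_distr X.M.add_minus_add intro!: restrict_ext)
  ultimately show "(\<lambda>a\<in>carrier A. d a \<oplus>\<^bsub>X\<^esub> e a) \<in> inner_derivation A X l r ` invariants S X l r"
    by (metis imageI)
qed

lemma derivation_quotients:
  assumes "S \<subseteq> carrier A"
  shows "HH1 K A X l r = quotient (fun_module A X (vanishing_derivations {}))
      (inner_derivation A X l r ` invariants {} X l r)"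
    and "relative_HH1 K A S X l r = quotient (fun_module A X (vanishing_derivations S))
      (inner_derivation A X l r ` invariants S X l r)"
    and "iota K A X l r = coset_map (fun_module A X (vanishing_derivations {}))
      (inner_derivation A X l r ` invariants {} X l r) (\<lambda>d. d)"
  by (simp_all add: HH1_def relative_HH1_def iota_def vanishing_derivations_def invariants_def
      relative_derivations_eq[OF assms])

end

text \<open>
  Injectivity of \<open>\<iota>\<close> holds because an inner derivation vanishes on the image of \<open>B\<close> only if it is given by
  an invariant element. For exactness in the middle one subtracts from \<open>d\<close> the inner derivation that
  agrees with it on \<open>B\<close>. Surjectivity of \<open>\<kappa>\<close> is the extension hypothesis, which provides a preimage
  already for derivations and not only for their classes.
\<close>

theorem short_exact_if_derivations_extend:
  assumes "algebra_hom K B A j" and "bimodule K A X l r"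
    and extend: "\<And>d. d \<in> derivations K B X (res_l j l) (res_r j r) \<Longrightarrow>
      \<exists>d'\<in>derivations K A X l r. \<forall>b\<in>carrier B. d' (j b) = d b"
  shows "short_exact K (relative_HH1 K A (j ` carrier B) X l r) (HH1 K A X l r)
      (HH1 K B X (res_l j l) (res_r j r)) (iota K A X l r) (kappa K B j X l r)"
proof -
  interpret j: algebra_hom K B A j by fact
  interpret A: algebra_bimodule K A X l r
    by (intro algebra_bimodule.intro assms(2) j.B.unital_algebra_axioms)
  interpret B: algebra_bimodule K B X "res_l j l" "res_r j r"
    by (intro algebra_bimodule.intro bimodule_restrict[OF assms(2,1)] j.A.unital_algebra_axioms)
  have S: "j ` carrier B \<subseteq> carrier A" by auto
  let ?M = "fun_module A X (A.vanishing_derivations {})"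
  let ?L = "fun_module A X (A.vanishing_derivations (j ` carrier B))"
  let ?N = "fun_module B X (B.vanishing_derivations {})"
  let ?res = "\<lambda>d. \<lambda>b\<in>carrier B. d (j b)"
  have kappa: "kappa K B j X l r = coset_map ?N
      (inner_derivation B X (res_l j l) (res_r j r) ` invariants {} X (res_l j l) (res_r j r)) ?res"
    by (simp add: kappa_def B.vanishing_derivations_def invariants_def)
  have modules: "Module.module K ?L" "Module.module K ?M" "Module.module K ?N"
    using S by (simp_all add: A.module_derivations B.module_derivations)
  have res_mem: "?res d \<in> B.vanishing_derivations {}" if "d \<in> A.vanishing_derivations {}" for d
  proof -
    have d: "d \<in> derivations K A X l r" using that by (simp add: A.vanishing_derivations_def)
    interpret d: linear_map K A X d using d by (rule A.linear_map_derivation)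
    have "linear_map K B X (\<lambda>b. d (j b))"
      by (intro linear_mapI j.A.module_axioms A.X.module_axioms) simp_all
    then show ?thesis
      using B.derivationI[of "\<lambda>b. d (j b)"] A.derivation_mult[OF d]
      unfolding B.vanishing_derivations_def by (simp add: res_l_def res_r_def)
  qed
  have res_inner: "?res (inner_derivation A X l r x) = inner_derivation B X (res_l j l) (res_r j r) x"
    for x by (auto simp: inner_derivation_def res_l_def res_r_def intro!: restrict_ext)
  show ?thesis
    unfolding A.derivation_quotients[OF S] B.derivation_quotients(1)[OF empty_subsetI] kappa
  proof (rule short_exact_quotients)
    show "linear_map K ?L ?M (\<lambda>d. d)"
      by (intro linear_mapI modules)
        (simp_all add: A.fun_module_simps A.vanishing_derivations_def)
    show "linear_map K ?M ?N ?res"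
      using res_mem
      by (intro linear_mapI modules) (auto simp: A.fun_module_simps B.fun_module_simps intro!: restrict_ext)
    show "submodule_of K ?L (inner_derivation A X l r ` invariants (j ` carrier B) X l r)"
      "submodule_of K ?M (inner_derivation A X l r ` invariants {} X l r)"
      "submodule_of K ?N
        (inner_derivation B X (res_l j l) (res_r j r) ` invariants {} X (res_l j l) (res_r j r))"
      by (intro A.submodule_inner_derivations B.submodule_inner_derivations S empty_subsetI)+
  next
    fix d assume "d \<in> carrier ?L"
    then have d: "\<forall>b\<in>j ` carrier B. d b = \<zero>\<^bsub>X\<^esub>"
      by (simp add: A.fun_module_simps A.vanishing_derivations_def)
    show "d \<in> inner_derivation A X l r ` invariants {} X l r \<longleftrightarrow>
        d \<in> inner_derivation A X l r ` invariants (j ` carrier B) X l r"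
      using d A.inner_derivation_eq_zero_iff[OF S] by (auto simp: invariants_def)
  next
    fix d assume "d \<in> carrier ?M"
    then have d: "d \<in> A.vanishing_derivations {}" by (simp add: A.fun_module_simps)
    let ?inner = "inner_derivation A X l r"
    let ?inner_B = "inner_derivation B X (res_l j l) (res_r j r)"
    show "?res d \<in> ?inner_B ` invariants {} X (res_l j l) (res_r j r) \<longleftrightarrow>
        (\<exists>e\<in>carrier ?L. \<exists>i\<in>?inner ` invariants {} X l r. d = i \<oplus>\<^bsub>?M\<^esub> e)"
    proof
      assume "?res d \<in> ?inner_B ` invariants {} X (res_l j l) (res_r j r)"
      then obtain x where x: "x \<in> carrier X" and eq: "?res d = ?res (?inner x)"
        by (auto simp: invariants_def res_inner)
      interpret M: Module.module K ?M by (rule modules)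
      have i: "?inner x \<in> carrier ?M" and d: "d \<in> carrier ?M"
        using d x A.inner_derivation_mem
        by (simp_all add: A.fun_module_simps A.vanishing_derivations_def)
      define e where "e = (\<ominus>\<^bsub>?M\<^esub> ?inner x) \<oplus>\<^bsub>?M\<^esub> d"
      have e: "e \<in> carrier ?M" "d = ?inner x \<oplus>\<^bsub>?M\<^esub> e"
        using i d by (simp_all add: e_def M.M.r_neg2)
      have "e (j b) = \<zero>\<^bsub>X\<^esub>" if b: "b \<in> carrier B" for b
      proof -
        have "d (j b) = ?inner x (j b) \<oplus>\<^bsub>X\<^esub> e (j b)"
          using b by (subst e(2)) (simp add: A.fun_module_simps)
        moreover have "d (j b) = ?inner x (j b)"
          using fun_cong[OF eq, of b] b by simp
        ultimately have eq: "?inner x (j b) \<oplus>\<^bsub>X\<^esub> e (j b) = ?inner x (j b)" by simp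
        have "?inner x (j b) \<in> carrier X" "e (j b) \<in> carrier X"
          using i e(1) b
          by (auto simp: A.fun_module_simps A.vanishing_derivations_def derivations_def)
        then show ?thesis using eq by simp
      qed
      then have "e \<in> carrier ?L"
        using e(1) by (auto simp: A.fun_module_simps A.vanishing_derivations_def)
      then show "\<exists>e\<in>carrier ?L. \<exists>i\<in>?inner ` invariants {} X l r. d = i \<oplus>\<^bsub>?M\<^esub> e"
        using e(2) x by (auto simp: invariants_def)
    next
      assume "\<exists>e\<in>carrier ?L. \<exists>i\<in>?inner ` invariants {} X l r. d = i \<oplus>\<^bsub>?M\<^esub> e"
      then obtain e x where e: "e \<in> carrier ?L" and x: "x \<in> carrier X" and
        eq: "d = ?inner x \<oplus>\<^bsub>?M\<^esub> e" by (auto simp: invariants_def)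
      have "d (j b) = ?inner x (j b)" if "b \<in> carrier B" for b
        using that e x unfolding eq
        by (simp add: A.fun_module_simps A.vanishing_derivations_def inner_derivation_def)
      then have "?res d = ?inner_B x"
        unfolding res_inner[symmetric] by (intro restrict_ext)
      then show "?res d \<in> ?inner_B ` invariants {} X (res_l j l) (res_r j r)"
        using x by (auto simp: invariants_def)
    qed
  next
    fix d assume "d \<in> carrier ?N"
    then have d: "d \<in> derivations K B X (res_l j l) (res_r j r)"
      by (simp add: B.fun_module_simps B.vanishing_derivations_def)
    then obtain d' where d': "d' \<in> derivations K A X l r" "\<forall>b\<in>carrier B. d' (j b) = d b"
      using extend by blast
    have "d = ?res d'"
      using d d'(2) by (auto simp: derivations_def intro!: PiE_ext)
    then show "\<exists>d'\<in>carrier ?M. d = ?res d'"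
      using d'(1) by (auto simp: A.fun_module_simps A.vanishing_derivations_def)
  qed
qed

section \<open>The path algebra of a quiver\<close>

lemma (in abelian_monoid) finsum_indicator:
  "\<lbrakk>finite S; x \<in> carrier G\<rbrakk> \<Longrightarrow>
    (\<Oplus>j\<in>S. if i = j then x else \<zero>) = (if i \<in> S then x else \<zero>)"
  using finsum_singleton[of i S "\<lambda>_. x"] by (cases "i \<in> S") (auto intro!: add.finprod_one_eqI)

context fin_digraph
begin

lemma Nil_path_iff [simp]: "(u, []) \<in> paths G \<longleftrightarrow> u \<in> verts G"
  by (auto simp: paths_def awalk_Nil_iff)

lemma Cons_path_iff: "(u, a # p) \<in> paths G \<longleftrightarrow> a \<in> arcs G \<and> u = tail G a \<and> (head G a, p) \<in> paths G"
  by (auto simp: paths_def awalk_Cons_iff)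

lemma path_target_Nil [simp]: "path_target G (u, []) = u"
  by (simp add: path_target_def)

lemma path_target_Cons [simp]: "path_target G (u, a # p) = path_target G (head G a, p)"
  by (cases p) (simp_all add: path_target_def)

lemma source_in_verts: "\<alpha> \<in> paths G \<Longrightarrow> path_source \<alpha> \<in> verts G"
  by (auto simp: paths_def path_source_def)

lemma target_in_verts: "\<alpha> \<in> paths G \<Longrightarrow> path_target G \<alpha> \<in> verts G"
  by (auto simp: paths_def path_target_def awlast_in_verts)

lemma path_target_comp: "path_target G \<alpha> = path_source \<beta> \<Longrightarrow> path_target G (path_comp \<beta> \<alpha>) = path_target G \<beta>"
  by (simp add: path_target_def path_comp_def path_source_def awlast_append)

lemma path_comp_in_paths:
  "\<lbrakk>\<alpha> \<in> paths G; \<beta> \<in> paths G; path_target G \<alpha> = path_source \<beta>\<rbrakk> \<Longrightarrow> path_comp \<beta> \<alpha> \<in> paths G"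
  by (auto simp: paths_def path_comp_def path_target_def path_source_def)

end

lemma path_source_comp [simp]: "path_source (path_comp \<beta> \<alpha>) = path_source \<alpha>"
  by (simp add: path_source_def path_comp_def)

lemma path_source_Pair [simp]: "path_source (u, p) = u"
  by (simp add: path_source_def)

lemma path_comp_assoc: "path_comp \<gamma> (path_comp \<beta> \<alpha>) = path_comp (path_comp \<gamma> \<beta>) \<alpha>"
  by (simp add: path_comp_def)

text \<open>The index set of the convolution sum that defines the product of the path algebra.\<close>

definition factorizations :: "('v, 'a) pre_digraph \<Rightarrow> ('v, 'a) path \<Rightarrow> (('v, 'a) path \<times> ('v, 'a) path) set" where
  "factorizations Q \<gamma> = {(\<beta>, \<alpha>). \<beta> \<in> paths Q \<and> \<alpha> \<in> paths Q \<and>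
    path_target Q \<alpha> = path_source \<beta> \<and> path_comp \<beta> \<alpha> = \<gamma>}"

text \<open>A factorization is determined by the length of the path that is traversed first.\<close>

lemma finite_factorizations [simp]: "finite (factorizations Q \<gamma>)"
proof (rule finite_subset)
  let ?split = "\<lambda>n. let \<alpha> = (fst \<gamma>, take n (snd \<gamma>)) in ((path_target Q \<alpha>, drop n (snd \<gamma>)), \<alpha>)"
  show "factorizations Q \<gamma> \<subseteq> ?split ` {..length (snd \<gamma>)}"
  proof
    fix x assume "x \<in> factorizations Q \<gamma>"
    then have "x = ?split (length (snd (snd x)))" "length (snd (snd x)) \<le> length (snd \<gamma>)"
      by (auto simp: factorizations_def path_comp_def path_source_def)
    then show "x \<in> ?split ` {..length (snd \<gamma>)}" by blast
  qed
qed simp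

locale quiver_algebra = K: cring K + fin_digraph Q
  for K :: "('k, 'm) ring_scheme" and Q :: "('v, 'a) pre_digraph"
begin

abbreviation P where "P \<equiv> path_algebra K Q"
abbreviation e where "e \<equiv> path_elem K"

lemma carrier_iff:
  "f \<in> carrier P \<longleftrightarrow> (\<forall>\<gamma>. f \<gamma> \<in> carrier K) \<and> (\<forall>\<gamma>. \<gamma> \<notin> paths Q \<longrightarrow> f \<gamma> = \<zero>\<^bsub>K\<^esub>) \<and>
    finite {\<gamma>. f \<gamma> \<noteq> \<zero>\<^bsub>K\<^esub>}"
  by (simp only: path_algebra_def partial_object.simps mem_Collect_eq)

lemma carrierI:
  "\<lbrakk>\<And>\<gamma>. f \<gamma> \<in> carrier K; \<And>\<gamma>. \<gamma> \<notin> paths Q \<Longrightarrow> f \<gamma> = \<zero>\<^bsub>K\<^esub>; finite {\<gamma>. f \<gamma> \<noteq> \<zero>\<^bsub>K\<^esub>}\<rbrakk> \<Longrightarrow>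
    f \<in> carrier P"
  unfolding carrier_iff by blast

lemma coeff_closed [simp]: "f \<in> carrier P \<Longrightarrow> f \<gamma> \<in> carrier K"
  unfolding carrier_iff by blast

lemma coeff_outside: "\<lbrakk>f \<in> carrier P; \<gamma> \<notin> paths Q\<rbrakk> \<Longrightarrow> f \<gamma> = \<zero>\<^bsub>K\<^esub>"
  unfolding carrier_iff by blast

lemma finite_support: "f \<in> carrier P \<Longrightarrow> finite {\<gamma>. f \<gamma> \<noteq> \<zero>\<^bsub>K\<^esub>}"
  unfolding carrier_iff by blast

lemma coeffs:
  "\<zero>\<^bsub>P\<^esub> \<gamma> = \<zero>\<^bsub>K\<^esub>"
  "(f \<oplus>\<^bsub>P\<^esub> g) \<gamma> = f \<gamma> \<oplus>\<^bsub>K\<^esub> g \<gamma>"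
  "(c \<odot>\<^bsub>P\<^esub> f) \<gamma> = c \<otimes>\<^bsub>K\<^esub> f \<gamma>"
  "\<one>\<^bsub>P\<^esub> \<gamma> = (if \<gamma> \<in> paths Q \<and> path_length \<gamma> = 0 then \<one>\<^bsub>K\<^esub> else \<zero>\<^bsub>K\<^esub>)"
  by (simp_all only: path_algebra_def module.simps ring.simps monoid.simps partial_object.simps)

lemma coeff_mult:
  "(f \<otimes>\<^bsub>P\<^esub> g) \<gamma> = (\<Oplus>\<^bsub>K\<^esub>x\<in>factorizations Q \<gamma>. f (fst x) \<otimes>\<^bsub>K\<^esub> g (snd x))"
  by (simp only: path_algebra_def monoid.simps factorizations_def case_prod_unfold)

lemma path_elem_closed [simp]: "\<gamma> \<in> paths Q \<Longrightarrow> e \<gamma> \<in> carrier P"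
  by (rule carrierI) (auto simp: path_elem_def)

lemma zero_closed: "\<zero>\<^bsub>P\<^esub> \<in> carrier P"
  by (rule carrierI) (simp_all add: coeffs)

lemma add_closed:
  assumes "f \<in> carrier P" "g \<in> carrier P"
  shows "f \<oplus>\<^bsub>P\<^esub> g \<in> carrier P"
proof (rule carrierI)
  have "{\<gamma>. (f \<oplus>\<^bsub>P\<^esub> g) \<gamma> \<noteq> \<zero>\<^bsub>K\<^esub>} \<subseteq> {\<gamma>. f \<gamma> \<noteq> \<zero>\<^bsub>K\<^esub>} \<union> {\<gamma>. g \<gamma> \<noteq> \<zero>\<^bsub>K\<^esub>}"
    by (auto simp: coeffs)
  then show "finite {\<gamma>. (f \<oplus>\<^bsub>P\<^esub> g) \<gamma> \<noteq> \<zero>\<^bsub>K\<^esub>}"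
    using assms finite_support by (blast intro: finite_subset)
qed (use assms in \<open>simp_all add: coeffs coeff_outside\<close>)

lemma smult_closed:
  assumes "c \<in> carrier K" "f \<in> carrier P"
  shows "c \<odot>\<^bsub>P\<^esub> f \<in> carrier P"
proof (rule carrierI)
  have "{\<gamma>. (c \<odot>\<^bsub>P\<^esub> f) \<gamma> \<noteq> \<zero>\<^bsub>K\<^esub>} \<subseteq> {\<gamma>. f \<gamma> \<noteq> \<zero>\<^bsub>K\<^esub>}"
    using assms(1) by (auto simp: coeffs)
  then show "finite {\<gamma>. (c \<odot>\<^bsub>P\<^esub> f) \<gamma> \<noteq> \<zero>\<^bsub>K\<^esub>}"
    using assms(2) finite_support by (blast intro: finite_subset)
qed (use assms in \<open>simp_all add: coeffs coeff_outside\<close>)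

lemma one_closed: "\<one>\<^bsub>P\<^esub> \<in> carrier P"
proof (rule carrierI)
  have "{\<gamma>. \<one>\<^bsub>P\<^esub> \<gamma> \<noteq> \<zero>\<^bsub>K\<^esub>} \<subseteq> (\<lambda>u. (u, [])) ` verts Q"
    by (auto simp: coeffs path_length_def)
  then show "finite {\<gamma>. \<one>\<^bsub>P\<^esub> \<gamma> \<noteq> \<zero>\<^bsub>K\<^esub>}"
    by (rule finite_subset) simp
qed (simp_all add: coeffs(4))

lemma mult_closed:
  assumes f: "f \<in> carrier P" and g: "g \<in> carrier P"
  shows "f \<otimes>\<^bsub>P\<^esub> g \<in> carrier P"
proof -
  let ?S = "(\<lambda>(\<beta>, \<alpha>). path_comp \<beta> \<alpha>) ` ({\<gamma>. f \<gamma> \<noteq> \<zero>\<^bsub>K\<^esub>} \<times> {\<gamma>. g \<gamma> \<noteq> \<zero>\<^bsub>K\<^esub>})"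
  have "(f \<otimes>\<^bsub>P\<^esub> g) \<gamma> = \<zero>\<^bsub>K\<^esub>" if "\<gamma> \<notin> ?S" for \<gamma>
    unfolding coeff_mult
  proof (rule K.add.finprod_one_eqI)
    fix x assume "x \<in> factorizations Q \<gamma>"
    then have "f (fst x) = \<zero>\<^bsub>K\<^esub> \<or> g (snd x) = \<zero>\<^bsub>K\<^esub>"
      using that by (force simp: factorizations_def)
    then show "f (fst x) \<otimes>\<^bsub>K\<^esub> g (snd x) = \<zero>\<^bsub>K\<^esub>" using f g by auto
  qed
  then have "{\<gamma>. (f \<otimes>\<^bsub>P\<^esub> g) \<gamma> \<noteq> \<zero>\<^bsub>K\<^esub>} \<subseteq> ?S" by blast
  moreover have "finite ?S" using finite_support f g by blast
  ultimately have "finite {\<gamma>. (f \<otimes>\<^bsub>P\<^esub> g) \<gamma> \<noteq> \<zero>\<^bsub>K\<^esub>}" by (rule finite_subset)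
  moreover have "(f \<otimes>\<^bsub>P\<^esub> g) \<gamma> = \<zero>\<^bsub>K\<^esub>" if "\<gamma> \<notin> paths Q" for \<gamma>
  proof -
    have "factorizations Q \<gamma> = {}"
      using that path_comp_in_paths by (auto simp: factorizations_def)
    then show ?thesis by (simp add: coeff_mult)
  qed
  moreover have "(f \<otimes>\<^bsub>P\<^esub> g) \<gamma> \<in> carrier K" for \<gamma>
    using f g unfolding coeff_mult by (intro K.finsum_closed) simp
  ultimately show ?thesis by (intro carrierI)
qed

lemma module_path_algebra: "Module.module K P"
proof (intro moduleI abelian_groupI)
  fix f assume f: "f \<in> carrier P"
  show "\<exists>g\<in>carrier P. g \<oplus>\<^bsub>P\<^esub> f = \<zero>\<^bsub>P\<^esub>"
    using f by (intro bexI[of _ "(\<ominus>\<^bsub>K\<^esub> \<one>\<^bsub>K\<^esub>) \<odot>\<^bsub>P\<^esub> f"] ext smult_closed)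
      (simp_all add: coeffs K.l_minus K.l_neg)
qed (auto simp: K.cring_axioms coeffs zero_closed add_closed smult_closed
    K.l_distr K.r_distr K.a_ac K.m_assoc intro!: ext)

sublocale P: Module.module K P
  by (rule module_path_algebra)

text \<open>
  The paths span the path algebra. Multilinear identities are reduced to paths with this rule, one argument at a
  time.
\<close>

lemma path_algebra_induct [consumes 1, case_names zero add]:
  assumes "f \<in> carrier P" and "Z \<zero>\<^bsub>P\<^esub>"
    and step: "\<And>c \<gamma> g. \<lbrakk>c \<in> carrier K; \<gamma> \<in> paths Q; g \<in> carrier P; Z g\<rbrakk> \<Longrightarrow>
      Z (c \<odot>\<^bsub>P\<^esub> e \<gamma> \<oplus>\<^bsub>P\<^esub> g)"
  shows "Z f"
proof -
  have "Z f" if "finite S" "f \<in> carrier P" "{\<gamma>. f \<gamma> \<noteq> \<zero>\<^bsub>K\<^esub>} \<subseteq> S" for S f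
    using that
  proof (induction S arbitrary: f)
    case empty
    then have "f = \<zero>\<^bsub>P\<^esub>" by (auto simp: coeffs)
    then show ?case using assms(2) by simp
  next
    case (insert \<gamma> S)
    show ?case
    proof (cases "f \<gamma> = \<zero>\<^bsub>K\<^esub>")
      case True
      then show ?thesis using insert by (intro insert.IH) auto
    next
      case False
      let ?g = "f(\<gamma> := \<zero>\<^bsub>K\<^esub>)"
      have \<gamma>: "\<gamma> \<in> paths Q" using False insert.prems(1) coeff_outside by blast
      have supp: "{\<delta>. ?g \<delta> \<noteq> \<zero>\<^bsub>K\<^esub>} \<subseteq> S" using insert.prems(2) by auto
      have g: "?g \<in> carrier P"
      proof (rule carrierI)
        show "finite {\<delta>. ?g \<delta> \<noteq> \<zero>\<^bsub>K\<^esub>}" using supp insert.hyps(1) by (rule finite_subset)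
      qed (use insert.prems(1) in \<open>simp_all add: coeff_outside\<close>)
      have "f = f \<gamma> \<odot>\<^bsub>P\<^esub> e \<gamma> \<oplus>\<^bsub>P\<^esub> ?g"
        using insert.prems(1) by (auto simp: coeffs path_elem_def)
      moreover have "Z ?g" using g supp by (rule insert.IH)
      ultimately show ?thesis
        using step[of "f \<gamma>" \<gamma> ?g] \<gamma> g insert.prems(1) by simp
    qed
  qed
  then show ?thesis using assms(1) finite_support by blast
qed

lemma linear_eqI:
  assumes "linear_map K P M g" "linear_map K P M h"
    and "\<And>\<gamma>. \<gamma> \<in> paths Q \<Longrightarrow> g (e \<gamma>) = h (e \<gamma>)" and "f \<in> carrier P"
  shows "g f = h f"
proof -
  interpret g: linear_map K P M g by fact
  interpret h: linear_map K P M h by fact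
  show ?thesis using assms(4) by (induction rule: path_algebra_induct) (simp_all add: assms(3))
qed

lemma path_elem_mult:
  assumes "\<beta> \<in> paths Q" "\<alpha> \<in> paths Q"
  shows "e \<beta> \<otimes>\<^bsub>P\<^esub> e \<alpha> =
    (if path_target Q \<alpha> = path_source \<beta> then e (path_comp \<beta> \<alpha>) else \<zero>\<^bsub>P\<^esub>)"
proof
  fix \<gamma>
  have "(e \<beta> \<otimes>\<^bsub>P\<^esub> e \<alpha>) \<gamma> = (\<Oplus>\<^bsub>K\<^esub>x\<in>factorizations Q \<gamma>. if (\<beta>, \<alpha>) = x then \<one>\<^bsub>K\<^esub> else \<zero>\<^bsub>K\<^esub>)"
    unfolding coeff_mult by (rule K.finsum_cong') (auto simp: path_elem_def)
  also have "\<dots> = (if (\<beta>, \<alpha>) \<in> factorizations Q \<gamma> then \<one>\<^bsub>K\<^esub> else \<zero>\<^bsub>K\<^esub>)"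
    by (simp add: K.finsum_indicator)
  also have "\<dots> = (if path_target Q \<alpha> = path_source \<beta> then e (path_comp \<beta> \<alpha>) else \<zero>\<^bsub>P\<^esub>) \<gamma>"
    using assms by (auto simp: factorizations_def path_elem_def coeffs)
  finally show "(e \<beta> \<otimes>\<^bsub>P\<^esub> e \<alpha>) \<gamma> = \<dots>" .
qed

lemma mult_distr:
  assumes "f \<in> carrier P" "g \<in> carrier P" "h \<in> carrier P"
  shows "(f \<oplus>\<^bsub>P\<^esub> g) \<otimes>\<^bsub>P\<^esub> h = f \<otimes>\<^bsub>P\<^esub> h \<oplus>\<^bsub>P\<^esub> g \<otimes>\<^bsub>P\<^esub> h"
    and "h \<otimes>\<^bsub>P\<^esub> (f \<oplus>\<^bsub>P\<^esub> g) = h \<otimes>\<^bsub>P\<^esub> f \<oplus>\<^bsub>P\<^esub> h \<otimes>\<^bsub>P\<^esub> g"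
  using assms
  by (simp_all add: fun_eq_iff coeffs coeff_mult K.l_distr K.r_distr K.finsum_addf)

lemma mult_smult:
  assumes "c \<in> carrier K" "f \<in> carrier P" "g \<in> carrier P"
  shows "(c \<odot>\<^bsub>P\<^esub> f) \<otimes>\<^bsub>P\<^esub> g = c \<odot>\<^bsub>P\<^esub> (f \<otimes>\<^bsub>P\<^esub> g)"
    and "f \<otimes>\<^bsub>P\<^esub> (c \<odot>\<^bsub>P\<^esub> g) = c \<odot>\<^bsub>P\<^esub> (f \<otimes>\<^bsub>P\<^esub> g)"
  using assms
  by (simp_all add: fun_eq_iff coeffs coeff_mult K.finsum_rdistr K.m_ac)

lemma mult_zero:
  "f \<in> carrier P \<Longrightarrow> \<zero>\<^bsub>P\<^esub> \<otimes>\<^bsub>P\<^esub> f = \<zero>\<^bsub>P\<^esub>" "f \<in> carrier P \<Longrightarrow> f \<otimes>\<^bsub>P\<^esub> \<zero>\<^bsub>P\<^esub> = \<zero>\<^bsub>P\<^esub>"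
  by (auto simp: coeffs coeff_mult intro!: ext K.add.finprod_one_eqI)

text \<open>
  Both sides are trilinear, and on paths the identity is the associativity of concatenation. The
  triples of paths that cannot be concatenated give zero on both sides.
\<close>

lemma mult_assoc:
  assumes "f \<in> carrier P" "g \<in> carrier P" "h \<in> carrier P"
  shows "(f \<otimes>\<^bsub>P\<^esub> g) \<otimes>\<^bsub>P\<^esub> h = f \<otimes>\<^bsub>P\<^esub> (g \<otimes>\<^bsub>P\<^esub> h)"
proof -
  note facts = mult_closed mult_distr mult_smult mult_zero
  have 1: "(e \<gamma> \<otimes>\<^bsub>P\<^esub> e \<beta>) \<otimes>\<^bsub>P\<^esub> e \<alpha> = e \<gamma> \<otimes>\<^bsub>P\<^esub> (e \<beta> \<otimes>\<^bsub>P\<^esub> e \<alpha>)"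
    if "\<gamma> \<in> paths Q" "\<beta> \<in> paths Q" "\<alpha> \<in> paths Q" for \<alpha> \<beta> \<gamma>
    using that
    by (simp add: path_elem_mult path_comp_in_paths path_target_comp path_comp_assoc mult_zero)
  have 2: "(e \<gamma> \<otimes>\<^bsub>P\<^esub> e \<beta>) \<otimes>\<^bsub>P\<^esub> h = e \<gamma> \<otimes>\<^bsub>P\<^esub> (e \<beta> \<otimes>\<^bsub>P\<^esub> h)"
    if "\<gamma> \<in> paths Q" "\<beta> \<in> paths Q" for \<beta> \<gamma>
    using assms(3) by (induction rule: path_algebra_induct) (simp_all add: facts that 1)
  have 3: "(e \<gamma> \<otimes>\<^bsub>P\<^esub> g) \<otimes>\<^bsub>P\<^esub> h = e \<gamma> \<otimes>\<^bsub>P\<^esub> (g \<otimes>\<^bsub>P\<^esub> h)" if "\<gamma> \<in> paths Q" for \<gamma>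
    using assms(2) by (induction rule: path_algebra_induct) (simp_all add: facts assms(3) that 2)
  show ?thesis
    using assms(1) by (induction rule: path_algebra_induct) (simp_all add: facts assms(2,3) 3)
qed

text \<open>
  The only factorizations of a path in which the left or the right factor has length zero are the ones at its
  target and at its source.
\<close>

lemma mult_one:
  assumes f: "f \<in> carrier P"
  shows "\<one>\<^bsub>P\<^esub> \<otimes>\<^bsub>P\<^esub> f = f" and "f \<otimes>\<^bsub>P\<^esub> \<one>\<^bsub>P\<^esub> = f"
proof -
  have "(\<one>\<^bsub>P\<^esub> \<otimes>\<^bsub>P\<^esub> f) \<gamma> = f \<gamma> \<and> (f \<otimes>\<^bsub>P\<^esub> \<one>\<^bsub>P\<^esub>) \<gamma> = f \<gamma>" for \<gamma>
  proof -
    let ?t = "((path_target Q \<gamma>, []), \<gamma>)" and ?s = "(\<gamma>, (path_source \<gamma>, []))"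
    have "(\<one>\<^bsub>P\<^esub> \<otimes>\<^bsub>P\<^esub> f) \<gamma> = (\<Oplus>\<^bsub>K\<^esub>x\<in>factorizations Q \<gamma>. if ?t = x then f \<gamma> else \<zero>\<^bsub>K\<^esub>)"
      unfolding coeff_mult using f
      by (intro K.finsum_cong')
        (auto simp: coeffs factorizations_def path_length_def path_source_def path_comp_def)
    moreover have "(f \<otimes>\<^bsub>P\<^esub> \<one>\<^bsub>P\<^esub>) \<gamma> = (\<Oplus>\<^bsub>K\<^esub>x\<in>factorizations Q \<gamma>. if ?s = x then f \<gamma> else \<zero>\<^bsub>K\<^esub>)"
      unfolding coeff_mult using f
      by (intro K.finsum_cong')
        (auto simp: coeffs factorizations_def path_length_def path_source_def path_comp_def)
    moreover have "?t \<in> factorizations Q \<gamma>" "?s \<in> factorizations Q \<gamma>" if "\<gamma> \<in> paths Q"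
      using that source_in_verts target_in_verts
      by (auto simp: factorizations_def path_comp_def path_source_def)
    ultimately show ?thesis
      using f coeff_outside[OF f, of \<gamma>] by (cases "\<gamma> \<in> paths Q") (simp_all add: K.finsum_indicator)
  qed
  then show "\<one>\<^bsub>P\<^esub> \<otimes>\<^bsub>P\<^esub> f = f" "f \<otimes>\<^bsub>P\<^esub> \<one>\<^bsub>P\<^esub> = f" by auto
qed

sublocale P: unital_algebra K P
proof (intro unital_algebra.intro unital_algebra_axioms.intro module_path_algebra)
  show "ring P"
    by (intro ringI monoidI P.M.abelian_group_axioms)
      (simp_all add: mult_closed one_closed mult_assoc mult_one mult_distr)
qed (simp_all add: mult_smult)

end

section \<open>Derivations of a path algebra\<close>

context quiver_algebra
begin

abbreviation vertex where "vertex v \<equiv> e (v, [])"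
abbreviation arrow where "arrow a \<equiv> e (tail Q a, [a])"

lemma arrow_path [simp]: "a \<in> arcs Q \<Longrightarrow> (tail Q a, [a]) \<in> paths Q"
  by (simp add: Cons_path_iff)

lemma path_elem_vertex:
  assumes "\<gamma> \<in> paths Q" "v \<in> verts Q"
  shows "e \<gamma> \<otimes>\<^bsub>P\<^esub> vertex v = (if v = path_source \<gamma> then e \<gamma> else \<zero>\<^bsub>P\<^esub>)"
    and "vertex v \<otimes>\<^bsub>P\<^esub> e \<gamma> = (if v = path_target Q \<gamma> then e \<gamma> else \<zero>\<^bsub>P\<^esub>)"
  using assms by (auto simp: path_elem_mult path_comp_def path_source_def)

lemma path_elem_arrow:
  "\<lbrakk>a \<in> arcs Q; (head Q a, p) \<in> paths Q\<rbrakk> \<Longrightarrow> e (head Q a, p) \<otimes>\<^bsub>P\<^esub> arrow a = e (tail Q a, a # p)"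
  by (simp add: path_elem_mult path_comp_def)

lemma path_induct [consumes 1, case_names Nil Cons]:
  assumes "\<gamma> \<in> paths Q"
    and "\<And>u. u \<in> verts Q \<Longrightarrow> Z (u, [])"
    and "\<And>a p. \<lbrakk>a \<in> arcs Q; (head Q a, p) \<in> paths Q; Z (head Q a, p)\<rbrakk> \<Longrightarrow> Z (tail Q a, a # p)"
  shows "Z \<gamma>"
proof -
  have "Z (u, p)" if "(u, p) \<in> paths Q" for u p
    using that by (induction p arbitrary: u) (auto simp: Cons_path_iff assms(2,3))
  then show ?thesis using assms(1) by (cases \<gamma>) simp
qed

text \<open>
  The paths are a basis: the coefficients of an element with respect to them are its values.
\<close>

lemma ex_linear_extension:
  assumes "Module.module K X" and D: "\<And>\<gamma>. \<gamma> \<in> paths Q \<Longrightarrow> D \<gamma> \<in> carrier X"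
  shows "\<exists>\<delta>. linear_map K P X \<delta> \<and> (\<forall>\<gamma>\<in>paths Q. \<delta> (e \<gamma>) = D \<gamma>)"
proof -
  interpret X: Module.module K X by fact
  let ?supp = "\<lambda>f. {\<gamma>. f \<gamma> \<noteq> \<zero>\<^bsub>K\<^esub>}"
  let ?sum = "\<lambda>f T. \<Oplus>\<^bsub>X\<^esub>\<gamma>\<in>T. f \<gamma> \<odot>\<^bsub>X\<^esub> D \<gamma>"
  define \<delta> where "\<delta> f = ?sum f (?supp f)" for f
  have supp: "finite (?supp f)" "?supp f \<subseteq> paths Q" if "f \<in> carrier P" for f
    using finite_support[OF that] coeff_outside[OF that] by auto
  \<comment> \<open>a set larger than the support allows \<open>f\<close> and \<open>g\<close> to be summed over the same paths\<close>
  have \<delta>_eq: "\<delta> f = ?sum f T" if "f \<in> carrier P" "finite T" "?supp f \<subseteq> T" "T \<subseteq> paths Q" for f T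
    unfolding \<delta>_def
  proof (rule X.M.add.finprod_mono_neutral_cong_left)
    show "(\<lambda>\<gamma>. f \<gamma> \<odot>\<^bsub>X\<^esub> D \<gamma>) \<in> T \<rightarrow> carrier X" using that(1,4) D by (intro Pi_I) (simp add: subsetD)
    fix \<gamma> assume "\<gamma> \<in> T - ?supp f"
    then show "f \<gamma> \<odot>\<^bsub>X\<^esub> D \<gamma> = \<zero>\<^bsub>X\<^esub>" using that(4) D by (simp add: subsetD)
  qed (use that in simp_all)
  have terms: "(\<lambda>\<gamma>. f \<gamma> \<odot>\<^bsub>X\<^esub> D \<gamma>) \<in> T \<rightarrow> carrier X" if "f \<in> carrier P" "T \<subseteq> paths Q" for f T
    using D that by (intro Pi_I) (simp add: subsetD)
  have "linear_map K P X \<delta>"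
  proof (intro linear_mapI module_path_algebra X.module_axioms)
    fix f assume f: "f \<in> carrier P"
    show "\<delta> f \<in> carrier X" unfolding \<delta>_def by (intro X.M.finsum_closed terms supp f)
    {
      fix c assume c: "c \<in> carrier K"
      have "\<delta> (c \<odot>\<^bsub>P\<^esub> f) = ?sum (c \<odot>\<^bsub>P\<^esub> f) (?supp f)"
        using c f by (intro \<delta>_eq supp) (auto simp: coeffs)
      also have "\<dots> = (\<Oplus>\<^bsub>X\<^esub>\<gamma>\<in>?supp f. c \<odot>\<^bsub>X\<^esub> (f \<gamma> \<odot>\<^bsub>X\<^esub> D \<gamma>))"
      proof (rule X.M.finsum_cong')
        fix \<gamma> assume "\<gamma> \<in> ?supp f"
        then have "\<gamma> \<in> paths Q" using supp(2)[OF f] by blast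
        then show "(c \<odot>\<^bsub>P\<^esub> f) \<gamma> \<odot>\<^bsub>X\<^esub> D \<gamma> = c \<odot>\<^bsub>X\<^esub> (f \<gamma> \<odot>\<^bsub>X\<^esub> D \<gamma>)"
          using c f D by (simp add: coeffs X.smult_assoc1)
      qed (use c terms[OF f supp(2)[OF f]] in \<open>auto simp: Pi_iff\<close>)
      also have "\<dots> = c \<odot>\<^bsub>X\<^esub> \<delta> f"
        unfolding \<delta>_def using c terms[OF f supp(2)[OF f]] supp(1)[OF f]
        by (intro X.finsum_smult_ldistr[symmetric])
      finally show "\<delta> (c \<odot>\<^bsub>P\<^esub> f) = c \<odot>\<^bsub>X\<^esub> \<delta> f" .
    }
    fix g assume g: "g \<in> carrier P"
    let ?T = "?supp f \<union> ?supp g"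
    have T: "finite ?T" "?T \<subseteq> paths Q" using supp[OF f] supp[OF g] by simp_all
    have "\<delta> (f \<oplus>\<^bsub>P\<^esub> g) = ?sum (f \<oplus>\<^bsub>P\<^esub> g) ?T"
      using f g T by (intro \<delta>_eq) (auto simp: coeffs)
    also have "\<dots> = (\<Oplus>\<^bsub>X\<^esub>\<gamma>\<in>?T. f \<gamma> \<odot>\<^bsub>X\<^esub> D \<gamma> \<oplus>\<^bsub>X\<^esub> g \<gamma> \<odot>\<^bsub>X\<^esub> D \<gamma>)"
    proof (rule X.M.finsum_cong')
      fix \<gamma> assume "\<gamma> \<in> ?T"
      then have "\<gamma> \<in> paths Q" using T(2) by blast
      then show "(f \<oplus>\<^bsub>P\<^esub> g) \<gamma> \<odot>\<^bsub>X\<^esub> D \<gamma> = f \<gamma> \<odot>\<^bsub>X\<^esub> D \<gamma> \<oplus>\<^bsub>X\<^esub> g \<gamma> \<odot>\<^bsub>X\<^esub> D \<gamma>"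
        using f g D by (simp add: coeffs X.smult_l_distr)
    qed (use terms[OF f T(2)] terms[OF g T(2)] in \<open>auto simp: Pi_iff\<close>)
    also have "\<dots> = ?sum f ?T \<oplus>\<^bsub>X\<^esub> ?sum g ?T"
      using terms[OF f T(2)] terms[OF g T(2)] by (rule X.M.finsum_addf)
    also have "\<dots> = \<delta> f \<oplus>\<^bsub>X\<^esub> \<delta> g"
      using \<delta>_eq[OF f T(1) _ T(2)] \<delta>_eq[OF g T(1) _ T(2)] by simp
    finally show "\<delta> (f \<oplus>\<^bsub>P\<^esub> g) = \<delta> f \<oplus>\<^bsub>X\<^esub> \<delta> g" .
  qed
  moreover have "\<delta> (e \<gamma>) = D \<gamma>" if "\<gamma> \<in> paths Q" for \<gamma>
  proof -
    have "\<delta> (e \<gamma>) = ?sum (e \<gamma>) {\<gamma>}"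
      using that by (intro \<delta>_eq path_elem_closed) (auto simp: path_elem_def)
    also have "\<dots> = D \<gamma>" using D[OF that] by (simp add: path_elem_def)
    finally show ?thesis .
  qed
  ultimately show ?thesis by blast
qed

end

locale quiver_bimodule = quiver_algebra K Q + algebra_bimodule K "path_algebra K Q" X l r
  for K :: "('k, 'm) ring_scheme" and Q :: "('v, 'a) pre_digraph"
    and X :: "('k, 'x, 'p) module_scheme" and l r
begin

text \<open>
  A derivation of the path algebra is determined by its values on vertices and arrows, since every longer path
  is a product of arrows.
\<close>

lemma leibniz_eqI:
  assumes d: "linear_map K P X d" "\<And>f g. \<lbrakk>f \<in> carrier P; g \<in> carrier P\<rbrakk> \<Longrightarrow>
      d (f \<otimes>\<^bsub>P\<^esub> g) = r (d f) g \<oplus>\<^bsub>X\<^esub> l f (d g)"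
    and d': "linear_map K P X d'" "\<And>f g. \<lbrakk>f \<in> carrier P; g \<in> carrier P\<rbrakk> \<Longrightarrow>
      d' (f \<otimes>\<^bsub>P\<^esub> g) = r (d' f) g \<oplus>\<^bsub>X\<^esub> l f (d' g)"
    and vertices: "\<And>v. v \<in> verts Q \<Longrightarrow> d (vertex v) = d' (vertex v)"
    and arrows: "\<And>a. a \<in> arcs Q \<Longrightarrow> d (arrow a) = d' (arrow a)"
    and f: "f \<in> carrier P"
  shows "d f = d' f"
  using d(1) d'(1) _ f
proof (rule linear_eqI)
  fix \<gamma> assume "\<gamma> \<in> paths Q"
  then show "d (e \<gamma>) = d' (e \<gamma>)"
  proof (induction rule: path_induct)
    case (Cons a p)
    then show ?case
      using d(2)[of "e (head Q a, p)" "arrow a"] d'(2)[of "e (head Q a, p)" "arrow a"]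
      by (simp add: path_elem_arrow arrows)
  qed (rule vertices)
qed

end

text \<open>
  The conditions on the values \<open>d0\<close> on vertices and \<open>d1\<close> on arrows are the Leibniz rule applied to the
  relations \<open>e\<^sub>u e\<^sub>v = \<delta>\<^sub>u\<^sub>v e\<^sub>u\<close>, \<open>a = e\<^sub>h a\<close> and \<open>a = a e\<^sub>t\<close>, where \<open>h\<close> is the head and \<open>t\<close> the tail of \<open>a\<close>. They
  are necessary for \<open>d0\<close> and \<open>d1\<close> to come from a derivation, and \<open>ex_derivation\<close> shows that they suffice.
\<close>

locale derivation_values = quiver_bimodule K Q X l r
  for K :: "('k, 'm) ring_scheme" and Q :: "('v, 'a) pre_digraph"
    and X :: "('k, 'x, 'p) module_scheme" and l r +
  fixes d0 :: "'v \<Rightarrow> 'x" and d1 :: "'a \<Rightarrow> 'x"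
  assumes d0_closed [simp]: "v \<in> verts Q \<Longrightarrow> d0 v \<in> carrier X"
    and d0_mult: "\<lbrakk>u \<in> verts Q; v \<in> verts Q\<rbrakk> \<Longrightarrow>
      r (d0 u) (vertex v) \<oplus>\<^bsub>X\<^esub> l (vertex u) (d0 v) = (if u = v then d0 u else \<zero>\<^bsub>X\<^esub>)"
    and d1_closed [simp]: "a \<in> arcs Q \<Longrightarrow> d1 a \<in> carrier X"
    and d1_head: "a \<in> arcs Q \<Longrightarrow>
      r (d0 (head Q a)) (arrow a) \<oplus>\<^bsub>X\<^esub> l (vertex (head Q a)) (d1 a) = d1 a"
    and d1_tail: "a \<in> arcs Q \<Longrightarrow>
      r (d1 a) (vertex (tail Q a)) \<oplus>\<^bsub>X\<^esub> l (arrow a) (d0 (tail Q a)) = d1 a"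
begin

text \<open>
  The list \<open>a # p\<close> starts with the arrow \<open>a\<close>, which is the rightmost factor of the path. So the second
  equation is the Leibniz rule for the product of \<open>p\<close> and \<open>a\<close>.
\<close>

primrec path_value :: "'v \<Rightarrow> 'a list \<Rightarrow> 'x" where
  "path_value u [] = d0 u"
| "path_value u (a # p) = r (path_value (head Q a) p) (arrow a) \<oplus>\<^bsub>X\<^esub> l (e (head Q a, p)) (d1 a)"

definition D :: "('v, 'a) path \<Rightarrow> 'x" where "D \<gamma> = path_value (fst \<gamma>) (snd \<gamma>)"

lemma D_simps [simp]:
  "D (u, []) = d0 u"
  "D (u, a # p) = r (D (head Q a, p)) (arrow a) \<oplus>\<^bsub>X\<^esub> l (e (head Q a, p)) (d1 a)"
  by (simp_all add: D_def)

lemma D_closed [simp]: "\<gamma> \<in> paths Q \<Longrightarrow> D \<gamma> \<in> carrier X"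
  by (induction rule: path_induct) simp_all

text \<open>
  The conditions on vertices and arrows propagate to paths: \<open>D\<close> satisfies the Leibniz rule for
  \<open>\<gamma> = \<gamma> e\<close>, where \<open>e\<close> is the source of \<open>\<gamma>\<close>, and for
  \<open>\<gamma> = e \<gamma>\<close>, where \<open>e\<close> is its target.
\<close>

lemma D_source:
  "\<gamma> \<in> paths Q \<Longrightarrow> r (D \<gamma>) (vertex (path_source \<gamma>)) \<oplus>\<^bsub>X\<^esub> l (e \<gamma>) (d0 (path_source \<gamma>)) = D \<gamma>"
proof (induction rule: path_induct)
  case (Cons a p)
  let ?v = "vertex (tail Q a)" and ?p = "e (head Q a, p)" and ?D = "D (head Q a, p)"
  have "r (r ?D (arrow a) \<oplus>\<^bsub>X\<^esub> l ?p (d1 a)) ?v \<oplus>\<^bsub>X\<^esub> l (e (tail Q a, a # p)) (d0 (tail Q a)) =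
      r ?D (arrow a \<otimes>\<^bsub>P\<^esub> ?v) \<oplus>\<^bsub>X\<^esub> l ?p (r (d1 a) ?v \<oplus>\<^bsub>X\<^esub> l (arrow a) (d0 (tail Q a)))"
    using Cons.hyps
    by (simp add: r_distr l_distr r_mult l_mult l_r X.M.a_assoc path_elem_arrow[OF Cons.hyps(1,2), symmetric])
  then show ?case using Cons.hyps by (simp add: path_elem_vertex d1_tail)
qed (simp add: d0_mult)

lemma D_target:
  "\<gamma> \<in> paths Q \<Longrightarrow> r (d0 (path_target Q \<gamma>)) (e \<gamma>) \<oplus>\<^bsub>X\<^esub> l (vertex (path_target Q \<gamma>)) (D \<gamma>) = D \<gamma>"
proof (induction rule: path_induct)
  case (Cons a p)
  let ?t = "path_target Q (head Q a, p)" and ?p = "e (head Q a, p)" and ?D = "D (head Q a, p)"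
  have t: "?t \<in> verts Q" using Cons.hyps by (intro target_in_verts)
  have "r (d0 ?t) (e (tail Q a, a # p)) \<oplus>\<^bsub>X\<^esub>
        l (vertex ?t) (r ?D (arrow a) \<oplus>\<^bsub>X\<^esub> l ?p (d1 a)) =
      r (r (d0 ?t) ?p \<oplus>\<^bsub>X\<^esub> l (vertex ?t) ?D) (arrow a) \<oplus>\<^bsub>X\<^esub> l (vertex ?t \<otimes>\<^bsub>P\<^esub> ?p) (d1 a)"
    using Cons.hyps t
    by (simp add: r_distr l_distr r_mult l_mult l_r X.M.a_assoc path_elem_arrow[OF Cons.hyps(1,2), symmetric])
  then show ?case using Cons t by (simp add: path_elem_vertex)
qed (simp add: d0_mult)

lemma D_comp:
  assumes "\<alpha> \<in> paths Q" "\<beta> \<in> paths Q" "path_target Q \<alpha> = path_source \<beta>"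
  shows "D (path_comp \<beta> \<alpha>) = r (D \<beta>) (e \<alpha>) \<oplus>\<^bsub>X\<^esub> l (e \<beta>) (D \<alpha>)"
  using assms(1,3)
proof (induction rule: path_induct)
  case (Nil u)
  then show ?case
    using D_source[OF assms(2)] by (simp add: path_comp_def path_source_def)
next
  case (Cons a p)
  let ?\<alpha> = "(head Q a, p)"
  have t: "path_target Q ?\<alpha> = path_source \<beta>" using Cons.prems by simp
  have comp: "path_comp \<beta> (tail Q a, a # p) = (tail Q a, a # (p @ snd \<beta>))"
    "path_comp \<beta> ?\<alpha> = (head Q a, p @ snd \<beta>)" by (simp_all add: path_comp_def)
  have "D (path_comp \<beta> (tail Q a, a # p)) =
      r (D (path_comp \<beta> ?\<alpha>)) (arrow a) \<oplus>\<^bsub>X\<^esub> l (e \<beta> \<otimes>\<^bsub>P\<^esub> e ?\<alpha>) (d1 a)"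
    using Cons.hyps assms(2) t by (simp add: comp path_elem_mult)
  also have "\<dots> = r (D \<beta>) (e ?\<alpha> \<otimes>\<^bsub>P\<^esub> arrow a) \<oplus>\<^bsub>X\<^esub> l (e \<beta>) (D (tail Q a, a # p))"
    using Cons.hyps assms(2) Cons.IH[OF t]
    by (simp add: r_distr l_distr r_mult l_mult l_r X.M.a_assoc)
  finally show ?case using Cons.hyps by (simp only: path_elem_arrow)
qed

text \<open>
  Let \<open>s\<close> be the source of \<open>\<beta>\<close> and \<open>t\<close> the target of \<open>\<alpha>\<close>. By the Leibniz rules for \<open>\<beta> = \<beta> e\<^sub>s\<close> and \<open>\<alpha> = e\<^sub>t \<alpha>\<close>
  the sum reduces to \<open>\<beta> (d0 s e\<^sub>t + e\<^sub>s d0 t) \<alpha>\<close>. The bracket is the Leibniz rule for \<open>e\<^sub>s e\<^sub>t = 0\<close>.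
\<close>

lemma D_not_comp:
  assumes "\<alpha> \<in> paths Q" "\<beta> \<in> paths Q" "path_target Q \<alpha> \<noteq> path_source \<beta>"
  shows "r (D \<beta>) (e \<alpha>) \<oplus>\<^bsub>X\<^esub> l (e \<beta>) (D \<alpha>) = \<zero>\<^bsub>X\<^esub>"
proof -
  let ?s = "path_source \<beta>" and ?t = "path_target Q \<alpha>"
  have st: "?s \<in> verts Q" "?t \<in> verts Q"
    using assms by (simp_all add: source_in_verts target_in_verts)
  have "r (D \<beta>) (e \<alpha>) = r (r (D \<beta>) (vertex ?s) \<oplus>\<^bsub>X\<^esub> l (e \<beta>) (d0 ?s)) (e \<alpha>)"
    using assms by (simp add: D_source)
  also have "\<dots> = r (D \<beta>) (vertex ?s \<otimes>\<^bsub>P\<^esub> e \<alpha>) \<oplus>\<^bsub>X\<^esub> l (e \<beta>) (r (d0 ?s) (e \<alpha>))"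
    using assms st by (simp add: r_distr r_mult l_r)
  also have "\<dots> = l (e \<beta>) (r (d0 ?s) (e \<alpha>))"
    using assms st by (simp add: path_elem_vertex)
  also have "\<dots> = l (e \<beta>) (r (d0 ?s) (vertex ?t \<otimes>\<^bsub>P\<^esub> e \<alpha>))"
    using assms st by (simp add: path_elem_vertex)
  finally have left: "r (D \<beta>) (e \<alpha>) = l (e \<beta>) (r (r (d0 ?s) (vertex ?t)) (e \<alpha>))"
    using assms st by (simp add: r_mult)
  have "l (e \<beta>) (D \<alpha>) = l (e \<beta>) (r (d0 ?t) (e \<alpha>) \<oplus>\<^bsub>X\<^esub> l (vertex ?t) (D \<alpha>))"
    using assms by (simp add: D_target)
  also have "\<dots> = l (e \<beta>) (r (d0 ?t) (e \<alpha>)) \<oplus>\<^bsub>X\<^esub> l (e \<beta> \<otimes>\<^bsub>P\<^esub> vertex ?t) (D \<alpha>)"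
    using assms st by (simp add: l_distr l_mult)
  also have "\<dots> = l (e \<beta> \<otimes>\<^bsub>P\<^esub> vertex ?s) (r (d0 ?t) (e \<alpha>))"
    using assms st by (simp add: path_elem_vertex)
  finally have right: "l (e \<beta>) (D \<alpha>) = l (e \<beta>) (r (l (vertex ?s) (d0 ?t)) (e \<alpha>))"
    using assms st by (simp add: l_mult l_r)
  have "r (D \<beta>) (e \<alpha>) \<oplus>\<^bsub>X\<^esub> l (e \<beta>) (D \<alpha>) =
      l (e \<beta>) (r (r (d0 ?s) (vertex ?t) \<oplus>\<^bsub>X\<^esub> l (vertex ?s) (d0 ?t)) (e \<alpha>))"
    unfolding left right using assms st by (simp add: l_distr r_distr)
  then show ?thesis using assms st by (simp add: d0_mult)
qed

text \<open>
  The linear extension of \<open>D\<close> satisfies the Leibniz rule on pairs of paths by \<open>D_comp\<close>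
  and \<open>D_not_comp\<close>, and hence everywhere, since both sides are bilinear.
\<close>

theorem ex_derivation:
  "\<exists>\<delta>\<in>derivations K P X l r. (\<forall>v\<in>verts Q. \<delta> (vertex v) = d0 v) \<and> (\<forall>a\<in>arcs Q. \<delta> (arrow a) = d1 a)"
proof -
  obtain \<delta> where "linear_map K P X \<delta>" and \<delta>: "\<And>\<gamma>. \<gamma> \<in> paths Q \<Longrightarrow> \<delta> (e \<gamma>) = D \<gamma>"
    using ex_linear_extension[of X D, OF X.module_axioms D_closed] by blast
  interpret \<delta>: linear_map K P X \<delta> by fact
  note facts = l_add r_add l_distr r_distr l_smult r_smult l_smult_right r_smult_left
    X.smult_r_distr X.M.a_ac mult_distr mult_smult
  have 1: "\<delta> (e \<beta> \<otimes>\<^bsub>P\<^esub> e \<alpha>) = r (\<delta> (e \<beta>)) (e \<alpha>) \<oplus>\<^bsub>X\<^esub> l (e \<beta>) (\<delta> (e \<alpha>))"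
    if "\<beta> \<in> paths Q" "\<alpha> \<in> paths Q" for \<beta> \<alpha>
    using that by (simp add: path_elem_mult \<delta> D_comp D_not_comp path_comp_in_paths)
  have 2: "\<delta> (e \<beta> \<otimes>\<^bsub>P\<^esub> g) = r (\<delta> (e \<beta>)) g \<oplus>\<^bsub>X\<^esub> l (e \<beta>) (\<delta> g)"
    if "g \<in> carrier P" "\<beta> \<in> paths Q" for \<beta> g
    using that by (induction rule: path_algebra_induct) (simp_all add: facts 1)
  have "\<delta> (f \<otimes>\<^bsub>P\<^esub> g) = r (\<delta> f) g \<oplus>\<^bsub>X\<^esub> l f (\<delta> g)" if "f \<in> carrier P" "g \<in> carrier P" for f g
    using that by (induction rule: path_algebra_induct) (simp_all add: facts 2)
  then have "restrict \<delta> (carrier P) \<in> derivations K P X l r"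
    by (intro derivationI \<delta>.linear_map_axioms)
  moreover have "\<delta> (arrow a) = d1 a" if "a \<in> arcs Q" for a
    using that D_simps(2)[of _ a "[]"] by (simp add: \<delta> d1_head)
  ultimately show ?thesis by (intro bexI) (simp_all add: \<delta>)
qed

end

text \<open>
  The value on an arrow \<open>a\<close> can always be chosen as \<open>x = d0(h) a + a d0(t)\<close>, with head \<open>h\<close> and tail \<open>t\<close> of
  \<open>a\<close>. The Leibniz rule for \<open>a = e\<^sub>h a\<close> asks that \<open>d0(h) a + e\<^sub>h x = x\<close>. Here \<open>e\<^sub>h x = a d0(t)\<close>, because
  \<open>e\<^sub>h d0(h) a = e\<^sub>h d0(h) e\<^sub>h a\<close> and \<open>e\<^sub>h d0(h) e\<^sub>h = 0\<close>. The last equation results from multiplying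
  \<open>d0(h) = d0(h) e\<^sub>h + e\<^sub>h d0(h)\<close> by \<open>e\<^sub>h\<close> on the left. The rule for \<open>a = a e\<^sub>t\<close> is symmetric.
\<close>

lemma (in quiver_bimodule) head_tail_of_arrow_value:
  assumes a: "a \<in> arcs Q"
    and d0_closed: "\<And>v. v \<in> verts Q \<Longrightarrow> d0 v \<in> carrier X"
    and d0_mult: "\<And>v. v \<in> verts Q \<Longrightarrow> r (d0 v) (vertex v) \<oplus>\<^bsub>X\<^esub> l (vertex v) (d0 v) = d0 v"
  defines "x \<equiv> r (d0 (head Q a)) (arrow a) \<oplus>\<^bsub>X\<^esub> l (arrow a) (d0 (tail Q a))"
  shows "x \<in> carrier X"
    and "r (d0 (head Q a)) (arrow a) \<oplus>\<^bsub>X\<^esub> l (vertex (head Q a)) x = x"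
    and "r x (vertex (tail Q a)) \<oplus>\<^bsub>X\<^esub> l (arrow a) (d0 (tail Q a)) = x"
proof -
  let ?h = "head Q a" and ?t = "tail Q a"
  \<comment> \<open>\<open>e d(e) e = 0\<close> for an idempotent \<open>e\<close>\<close>
  have corner: "l (vertex v) (r (d0 v) (vertex v)) = \<zero>\<^bsub>X\<^esub>" if v: "v \<in> verts Q" for v
  proof -
    have "l (vertex v) (d0 v) = l (vertex v) (r (d0 v) (vertex v) \<oplus>\<^bsub>X\<^esub> l (vertex v) (d0 v))"
      using v by (simp add: d0_mult)
    also have "\<dots> = l (vertex v) (r (d0 v) (vertex v)) \<oplus>\<^bsub>X\<^esub> l (vertex v \<otimes>\<^bsub>P\<^esub> vertex v) (d0 v)"
      using v by (simp add: l_distr l_mult d0_closed)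
    also have "vertex v \<otimes>\<^bsub>P\<^esub> vertex v = vertex v"
      using v by (simp add: path_elem_vertex)
    finally show ?thesis using v by (simp add: d0_closed)
  qed
  have ar: "vertex ?h \<otimes>\<^bsub>P\<^esub> arrow a = arrow a" "arrow a \<otimes>\<^bsub>P\<^esub> vertex ?t = arrow a"
    using a by (simp_all add: path_elem_vertex)
  show "x \<in> carrier X" using a by (simp add: x_def d0_closed)
  have "l (vertex ?h) (r (d0 ?h) (vertex ?h \<otimes>\<^bsub>P\<^esub> arrow a)) = \<zero>\<^bsub>X\<^esub>"
    using a corner[of ?h] by (simp add: r_mult d0_closed flip: l_r)
  moreover have "l (vertex ?h) (l (arrow a) (d0 ?t)) = l (arrow a) (d0 ?t)"
    using a by (simp add: d0_closed ar flip: l_mult)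
  ultimately show "r (d0 ?h) (arrow a) \<oplus>\<^bsub>X\<^esub> l (vertex ?h) x = x"
    using a by (simp add: x_def l_distr ar d0_closed)
  have "l (arrow a \<otimes>\<^bsub>P\<^esub> vertex ?t) (r (d0 ?t) (vertex ?t)) = \<zero>\<^bsub>X\<^esub>"
    using a corner[of ?t] by (simp add: l_mult d0_closed)
  then have "r (l (arrow a) (d0 ?t)) (vertex ?t) = \<zero>\<^bsub>X\<^esub>"
    using a by (simp add: l_r d0_closed ar)
  moreover have "r (r (d0 ?h) (arrow a)) (vertex ?t) = r (d0 ?h) (arrow a)"
    using a by (simp add: d0_closed ar flip: r_mult)
  ultimately show "r x (vertex ?t) \<oplus>\<^bsub>X\<^esub> l (arrow a) (d0 ?t) = x"
    using a by (simp add: x_def r_distr d0_closed)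
qed

section \<open>Adjoining arrows\<close>

lemma fin_digraph_quiver_F:
  assumes "fin_digraph Q" "new_arrows Q F s t"
  shows "fin_digraph (quiver_F Q F s t)"
proof -
  interpret fin_digraph Q by fact
  interpret new_arrows Q F s t by fact
  show ?thesis
    using s_closed t_closed finite_F
    by unfold_locales (auto simp: quiver_F_def)
qed

locale quiver_with_new_arrows = Q: quiver_algebra K Q + new_arrows Q F s t
  for K :: "('k, 'm) ring_scheme" and Q :: "('v, 'a) pre_digraph"
    and F :: "'f set" and s t :: "'f \<Rightarrow> 'v"
begin

abbreviation Q\<^sub>F where "Q\<^sub>F \<equiv> quiver_F Q F s t"

sublocale Q\<^sub>F: quiver_algebra K Q\<^sub>F
  by (intro quiver_algebra.intro Q.K.cring_axioms fin_digraph_quiver_F Q.fin_digraph_axioms new_arrows_axioms)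

abbreviation incl :: "(('v, 'a) path \<Rightarrow> 'k) \<Rightarrow> ('v, 'a + 'f) path \<Rightarrow> 'k" where
  "incl \<equiv> path_algebra_incl K"

lemma Plus_iff [simp]: "Inl a \<in> A <+> C \<longleftrightarrow> a \<in> A" "Inr b \<in> A <+> C \<longleftrightarrow> b \<in> C"
  by auto

lemma quiver_F_simps [simp]:
  "verts Q\<^sub>F = verts Q" "arcs Q\<^sub>F = arcs Q <+> F"
  "tail Q\<^sub>F (Inl a) = tail Q a" "head Q\<^sub>F (Inl a) = head Q a"
  "tail Q\<^sub>F (Inr f) = s f" "head Q\<^sub>F (Inr f) = t f"
  by (simp_all add: quiver_F_def)

lemma map_Inl_path_iff [simp]: "(u, map Inl p) \<in> paths Q\<^sub>F \<longleftrightarrow> (u, p) \<in> paths Q"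
  by (induction p arbitrary: u) (auto simp: Q.Cons_path_iff Q\<^sub>F.Cons_path_iff)

lemma path_target_map_Inl [simp]: "path_target Q\<^sub>F (u, map Inl p) = path_target Q (u, p)"
  by (induction p arbitrary: u) simp_all

lemma map_Inl_projl: "set q \<subseteq> range Inl \<Longrightarrow> map Inl (map projl q) = q"
  by (induction q) auto

lemma incl_eq: "incl f (u, map Inl p) = f (u, p)"
  by (auto simp: path_algebra_incl_def o_def)

lemma incl_eq_zero: "\<not> set q \<subseteq> range Inl \<Longrightarrow> incl f (u, q) = \<zero>\<^bsub>K\<^esub>"
  by (auto simp: path_algebra_incl_def)

lemma incl_cases:
  obtains p where "q = map Inl p" | "\<not> set q \<subseteq> range Inl"
  using map_Inl_projl by metis

lemma incl_closed:
  assumes f: "f \<in> carrier Q.P"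
  shows "incl f \<in> carrier Q\<^sub>F.P"
proof (rule Q\<^sub>F.carrierI)
  show "incl f \<gamma> \<in> carrier K" for \<gamma>
    using f by (cases \<gamma>) (auto simp: path_algebra_incl_def)
  show "incl f \<gamma> = \<zero>\<^bsub>K\<^esub>" if "\<gamma> \<notin> paths Q\<^sub>F" for \<gamma>
  proof -
    obtain u q where \<gamma>: "\<gamma> = (u, q)" by fastforce
    show ?thesis
      by (cases q rule: incl_cases)
        (use that Q.coeff_outside[OF f] in \<open>simp_all add: \<gamma> incl_eq incl_eq_zero\<close>)
  qed
  have "{\<gamma>. incl f \<gamma> \<noteq> \<zero>\<^bsub>K\<^esub>} \<subseteq> (\<lambda>(u, p). (u, map Inl p)) ` {\<gamma>. f \<gamma> \<noteq> \<zero>\<^bsub>K\<^esub>}"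
  proof
    fix \<gamma> assume nz: "\<gamma> \<in> {\<gamma>. incl f \<gamma> \<noteq> \<zero>\<^bsub>K\<^esub>}"
    obtain u q where \<gamma>: "\<gamma> = (u, q)" by fastforce
    show "\<gamma> \<in> (\<lambda>(u, p). (u, map Inl p)) ` {\<gamma>. f \<gamma> \<noteq> \<zero>\<^bsub>K\<^esub>}"
      by (cases q rule: incl_cases)
        (use nz in \<open>auto simp: \<gamma> incl_eq incl_eq_zero intro!: image_eqI[of _ _ "(u, _)"]\<close>)
  qed
  then show "finite {\<gamma>. incl f \<gamma> \<noteq> \<zero>\<^bsub>K\<^esub>}"
    using Q.finite_support[OF f] by (blast intro: finite_subset)
qed

lemma incl_linear: "linear_map K Q.P Q\<^sub>F.P incl"
proof (intro linear_mapI Q.module_path_algebra Q\<^sub>F.module_path_algebra incl_closed ext)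
  fix f g \<gamma> assume "f \<in> carrier Q.P" "g \<in> carrier Q.P"
  show "incl (f \<oplus>\<^bsub>Q.P\<^esub> g) \<gamma> = (incl f \<oplus>\<^bsub>Q\<^sub>F.P\<^esub> incl g) \<gamma>"
    by (cases \<gamma>) (simp add: path_algebra_incl_def Q.coeffs Q\<^sub>F.coeffs)
next
  fix c f \<gamma> assume "c \<in> carrier K"
  then show "incl (c \<odot>\<^bsub>Q.P\<^esub> f) \<gamma> = (c \<odot>\<^bsub>Q\<^sub>F.P\<^esub> incl f) \<gamma>"
    by (cases \<gamma>) (simp add: path_algebra_incl_def Q.coeffs Q\<^sub>F.coeffs)
qed

lemma incl_path_elem: "incl (Q.e (u, p)) = Q\<^sub>F.e (u, map Inl p)"
proof
  fix \<gamma> :: "('v, 'a + 'f) path"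
  obtain v q where \<gamma>: "\<gamma> = (v, q)" by fastforce
  show "incl (Q.e (u, p)) \<gamma> = Q\<^sub>F.e (u, map Inl p) \<gamma>"
  proof (cases q rule: incl_cases)
    case (1 p')
    then show ?thesis by (simp add: \<gamma> incl_eq path_elem_def inj_map_eq_map)
  next
    case 2
    then show ?thesis by (auto simp: \<gamma> incl_eq_zero path_elem_def)
  qed
qed

lemma incl_one: "incl \<one>\<^bsub>Q.P\<^esub> = \<one>\<^bsub>Q\<^sub>F.P\<^esub>"
proof
  fix \<gamma> :: "('v, 'a + 'f) path"
  obtain v q where \<gamma>: "\<gamma> = (v, q)" by fastforce
  show "incl \<one>\<^bsub>Q.P\<^esub> \<gamma> = \<one>\<^bsub>Q\<^sub>F.P\<^esub> \<gamma>"
    by (cases q) (auto simp: \<gamma> path_algebra_incl_def Q.coeffs Q\<^sub>F.coeffs path_length_def)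
qed

lemma algebra_hom_incl: "algebra_hom K Q.P Q\<^sub>F.P incl"
proof -
  interpret linear_map K Q.P Q\<^sub>F.P incl by (rule incl_linear)
  note facts = Q.mult_distr Q.mult_smult Q\<^sub>F.mult_distr Q\<^sub>F.mult_smult
  have 1: "incl (Q.e \<beta> \<otimes>\<^bsub>Q.P\<^esub> Q.e \<alpha>) = incl (Q.e \<beta>) \<otimes>\<^bsub>Q\<^sub>F.P\<^esub> incl (Q.e \<alpha>)"
    if "\<beta> \<in> paths Q" "\<alpha> \<in> paths Q" for \<beta> \<alpha>
    using that by (cases \<beta>; cases \<alpha>)
      (simp add: Q.path_elem_mult Q\<^sub>F.path_elem_mult incl_path_elem path_comp_def)
  have 2: "incl (Q.e \<beta> \<otimes>\<^bsub>Q.P\<^esub> g) = incl (Q.e \<beta>) \<otimes>\<^bsub>Q\<^sub>F.P\<^esub> incl g"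
    if "g \<in> carrier Q.P" "\<beta> \<in> paths Q" for \<beta> g
    using that by (induction rule: Q.path_algebra_induct) (simp_all add: facts 1)
  have "incl (f \<otimes>\<^bsub>Q.P\<^esub> g) = incl f \<otimes>\<^bsub>Q\<^sub>F.P\<^esub> incl g" if "f \<in> carrier Q.P" "g \<in> carrier Q.P" for f g
    using that by (induction rule: Q.path_algebra_induct) (simp_all add: facts 2)
  then show ?thesis
    by (intro algebra_hom.intro algebra_hom_axioms.intro incl_linear incl_one
        Q.P.unital_algebra_axioms Q\<^sub>F.P.unital_algebra_axioms)
qed

end

locale bound_quiver_with_new_arrows = quiver_with_new_arrows K Q F s t + I: ideal I "path_algebra K Q"
  for K :: "('k, 'm) ring_scheme" and Q :: "('v, 'a) pre_digraph"
    and F :: "'f set" and s t :: "'f \<Rightarrow> 'v" and I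
begin

abbreviation "J \<equiv> ideal_F K Q I F s t"
abbreviation "B \<equiv> bound_quiver_algebra K Q I"
abbreviation "B\<^sub>F \<equiv> algebra_F K Q I F s t"
abbreviation "j \<equiv> canonical_map K Q I F s t"

sublocale incl: algebra_hom K Q.P Q\<^sub>F.P incl
  by (rule algebra_hom_incl)

lemma incl_I_subset: "incl ` I \<subseteq> carrier Q\<^sub>F.P"
  using I.a_subset by auto

lemma incl_I_subset_J: "incl ` I \<subseteq> J"
  unfolding ideal_F_def by (rule Q\<^sub>F.P.genideal_self[OF incl_I_subset])

sublocale B: algebra_ideal K Q.P I
  by (intro algebra_ideal.intro Q.P.unital_algebra_axioms I.ideal_axioms)

sublocale B\<^sub>F: algebra_ideal K Q\<^sub>F.P J
  unfolding ideal_F_def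
  by (intro algebra_ideal.intro Q\<^sub>F.P.unital_algebra_axioms Q\<^sub>F.P.genideal_ideal incl_I_subset)

lemma algebra_hom_canonical_map: "algebra_hom K B B\<^sub>F j"
  unfolding bound_quiver_algebra_def algebra_F_def canonical_map_def
  by (rule algebra_hom_coset_map[OF algebra_hom_incl I.ideal_axioms B\<^sub>F.ideal_axioms incl_I_subset_J])

lemma canonical_map_coset: "f \<in> carrier Q.P \<Longrightarrow> j (I +>\<^bsub>Q.P\<^esub> f) = J +>\<^bsub>Q\<^sub>F.P\<^esub> incl f"
  unfolding canonical_map_def
  by (rule algebra_hom_coset_map[OF algebra_hom_incl I.ideal_axioms B\<^sub>F.ideal_axioms incl_I_subset_J])

text \<open>
  The elements of \<open>J\<close> on which \<open>\<delta>\<close> vanishes form an ideal: if \<open>f\<close> is one of them, then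
  \<open>\<delta>(g f) = \<delta>(g) f + g \<delta>(f)\<close>, where the first term is zero because \<open>J\<close> acts by zero on \<open>X\<close>. This ideal
  contains the generators of \<open>J\<close>.
\<close>

lemma leibniz_vanishes_on_J:
  assumes "algebra_bimodule K Q\<^sub>F.P X l r" and \<delta>: "\<delta> \<in> derivations K Q\<^sub>F.P X l r"
    and acts: "\<And>f x. \<lbrakk>f \<in> J; x \<in> carrier X\<rbrakk> \<Longrightarrow> l f x = \<zero>\<^bsub>X\<^esub> \<and> r x f = \<zero>\<^bsub>X\<^esub>"
    and zero: "\<And>f. f \<in> I \<Longrightarrow> \<delta> (incl f) = \<zero>\<^bsub>X\<^esub>" and f: "f \<in> J"
  shows "\<delta> f = \<zero>\<^bsub>X\<^esub>"
proof -
  interpret algebra_bimodule K Q\<^sub>F.P X l r by fact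
  interpret \<delta>: linear_map K Q\<^sub>F.P X \<delta> using \<delta> by (rule linear_map_derivation)
  let ?Z = "{f \<in> J. \<delta> f = \<zero>\<^bsub>X\<^esub>}"
  interpret Z: submodule_of K Q\<^sub>F.P ?Z
    using B\<^sub>F.smult_mem by (intro submodule_ofI Q\<^sub>F.module_path_algebra) auto
  have "ideal ?Z Q\<^sub>F.P"
  proof (rule idealI)
    show "ring Q\<^sub>F.P" by (rule Q\<^sub>F.P.ring_axioms)
    show "subgroup ?Z (add_monoid Q\<^sub>F.P)" by (rule Z.N.a_subgroup)
  qed (auto simp: B\<^sub>F.I_l_closed B\<^sub>F.I_r_closed derivation_mult[OF \<delta>] acts)
  then have "J \<subseteq> ?Z"
    unfolding ideal_F_def
    by (rule Q\<^sub>F.P.genideal_minimal) (use incl_I_subset_J zero in \<open>auto simp: ideal_F_def\<close>)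
  then show ?thesis using f by blast
qed

text \<open>
  The derivation \<open>d\<close> of \<open>B\<close> is pulled back to \<open>kQ\<close>, extended to \<open>kQ\<^sub>F\<close> with the values
  \<open>d(e\<^sub>v) f + f d(e\<^sub>u)\<close> on the new arrows \<open>f\<close> from \<open>u\<close> to \<open>v\<close>, and pushed down to \<open>B\<^sub>F\<close>.
\<close>

theorem derivation_extends:
  assumes "bimodule K B\<^sub>F X l r" and d: "d \<in> derivations K B X (res_l j l) (res_r j r)"
  shows "\<exists>d'\<in>derivations K B\<^sub>F X l r. \<forall>b\<in>carrier B. d' (j b) = d b"
proof -
  let ?P = "path_algebra K Q" and ?P\<^sub>F = "path_algebra K Q\<^sub>F"
  define \<pi> where "\<pi> = (\<lambda>f. I +>\<^bsub>?P\<^esub> f)"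
  define \<pi>\<^sub>F where "\<pi>\<^sub>F = (\<lambda>f. J +>\<^bsub>?P\<^sub>F\<^esub> f)"
  define l' where "l' = res_l \<pi>\<^sub>F l"
  define r' where "r' = res_r \<pi>\<^sub>F r"
  interpret j: algebra_hom K B B\<^sub>F j by (rule algebra_hom_canonical_map)
  interpret \<pi>: algebra_hom K ?P B \<pi>
    unfolding \<pi>_def bound_quiver_algebra_def by (rule B.algebra_hom_coset)
  interpret \<pi>\<^sub>F: algebra_hom K ?P\<^sub>F B\<^sub>F \<pi>\<^sub>F
    unfolding \<pi>\<^sub>F_def algebra_F_def by (rule B\<^sub>F.algebra_hom_coset)
  have j_\<pi>: "j (\<pi> f) = \<pi>\<^sub>F (incl f)" if "f \<in> carrier ?P" for f
    using that canonical_map_coset by (simp add: \<pi>_def \<pi>\<^sub>F_def)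
  interpret X: algebra_bimodule K B\<^sub>F X l r
    by (intro algebra_bimodule.intro assms(1) j.B.unital_algebra_axioms)
  interpret XB: algebra_bimodule K B X "res_l j l" "res_r j r"
    by (intro algebra_bimodule.intro bimodule_restrict[OF assms(1)] j.algebra_hom_axioms
        j.A.unital_algebra_axioms)
  interpret X\<^sub>F: quiver_bimodule K Q\<^sub>F X l' r'
    unfolding l'_def r'_def
    by (intro quiver_bimodule.intro algebra_bimodule.intro bimodule_restrict[OF assms(1)]
        Q\<^sub>F.quiver_algebra_axioms \<pi>\<^sub>F.algebra_hom_axioms Q\<^sub>F.P.unital_algebra_axioms)
  interpret X\<^sub>Q: quiver_bimodule K Q X "res_l incl l'" "res_r incl r'"
    by (intro quiver_bimodule.intro algebra_bimodule.intro bimodule_restrict[OF X\<^sub>F.bimodule_axioms]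
        Q.quiver_algebra_axioms incl.algebra_hom_axioms Q.P.unital_algebra_axioms)
  interpret d: linear_map K B X d using d by (rule XB.linear_map_derivation)

  \<comment> \<open>the pullback of \<open>d\<close> to \<open>kQ\<close>\<close>
  define dP where "dP f = d (\<pi> f)" for f
  interpret dP: linear_map K ?P X dP
    unfolding dP_def by (intro linear_mapI Q.module_path_algebra X.X.module_axioms) simp_all
  have dP_mult: "dP (f \<otimes>\<^bsub>?P\<^esub> g) = r' (dP f) (incl g) \<oplus>\<^bsub>X\<^esub> l' (incl f) (dP g)"
    if "f \<in> carrier ?P" "g \<in> carrier ?P" for f g
    using that XB.derivation_mult[OF d]
    by (simp add: dP_def res_l_def res_r_def j_\<pi> l'_def r'_def)

  define d0 where "d0 v = dP (Q.vertex v)" for v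
  have d0_closed: "d0 v \<in> carrier X" if "v \<in> verts Q" for v
    using that by (simp add: d0_def)
  have d0_mult: "r' (d0 u) (Q\<^sub>F.vertex v) \<oplus>\<^bsub>X\<^esub> l' (Q\<^sub>F.vertex u) (d0 v) =
      (if u = v then d0 u else \<zero>\<^bsub>X\<^esub>)" if "u \<in> verts Q" "v \<in> verts Q" for u v
    using that dP_mult[of "Q.vertex u" "Q.vertex v"]
    by (auto simp: d0_def incl_path_elem Q.path_elem_vertex)
  define d1 where "d1 = case_sum (\<lambda>a. dP (Q.arrow a))
    (\<lambda>f. r' (d0 (t f)) (Q\<^sub>F.arrow (Inr f)) \<oplus>\<^bsub>X\<^esub> l' (Q\<^sub>F.arrow (Inr f)) (d0 (s f)))"
  \<comment> \<open>the relations hold on new arrows by the choice of \<open>d1\<close>, on old ones by the Leibniz rule for \<open>d\<close>\<close>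
  have new: "d1 (Inr f) \<in> carrier X"
    "r' (d0 (t f)) (Q\<^sub>F.arrow (Inr f)) \<oplus>\<^bsub>X\<^esub> l' (Q\<^sub>F.vertex (t f)) (d1 (Inr f)) = d1 (Inr f)"
    "r' (d1 (Inr f)) (Q\<^sub>F.vertex (s f)) \<oplus>\<^bsub>X\<^esub> l' (Q\<^sub>F.arrow (Inr f)) (d0 (s f)) = d1 (Inr f)"
    if "f \<in> F" for f
    using X\<^sub>F.head_tail_of_arrow_value[of "Inr f" d0] that d0_closed d0_mult
    by (simp_all add: d1_def)
  have old: "d1 (Inl a) \<in> carrier X"
    "r' (d0 (head Q a)) (Q\<^sub>F.arrow (Inl a)) \<oplus>\<^bsub>X\<^esub> l' (Q\<^sub>F.vertex (head Q a)) (d1 (Inl a)) = d1 (Inl a)"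
    "r' (d1 (Inl a)) (Q\<^sub>F.vertex (tail Q a)) \<oplus>\<^bsub>X\<^esub> l' (Q\<^sub>F.arrow (Inl a)) (d0 (tail Q a)) = d1 (Inl a)"
    if a: "a \<in> arcs Q" for a
    using a dP_mult[of "Q.vertex (head Q a)" "Q.arrow a"] dP_mult[of "Q.arrow a" "Q.vertex (tail Q a)"]
    by (simp_all add: d1_def d0_def incl_path_elem Q.path_elem_vertex)
  interpret derivation_values K Q\<^sub>F X l' r' d0 d1
    by unfold_locales (use d0_closed d0_mult old new in auto)
  obtain \<delta> where \<delta>: "\<delta> \<in> derivations K ?P\<^sub>F X l' r'"
    and \<delta>_vertex: "\<forall>v\<in>verts Q\<^sub>F. \<delta> (Q\<^sub>F.vertex v) = d0 v"
    and \<delta>_arrow: "\<forall>a\<in>arcs Q\<^sub>F. \<delta> (Q\<^sub>F.arrow a) = d1 a"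
    using ex_derivation by blast
  interpret \<delta>: linear_map K ?P\<^sub>F X \<delta> using \<delta> by (rule X\<^sub>F.linear_map_derivation)

  \<comment> \<open>\<open>\<delta>\<close> extends the pullback of \<open>d\<close>, since the two agree on the vertices and arrows of \<open>Q\<close>\<close>
  have \<delta>_incl: "\<delta> (incl f) = dP f" if f: "f \<in> carrier ?P" for f
  proof (rule X\<^sub>Q.leibniz_eqI[OF _ _ dP.linear_map_axioms _ _ _ f])
    show "linear_map K ?P X (\<lambda>f. \<delta> (incl f))"
      by (intro linear_mapI Q.module_path_algebra X.X.module_axioms) simp_all
  next
    fix v assume "v \<in> verts Q"
    then show "\<delta> (incl (Q.vertex v)) = dP (Q.vertex v)"
      using \<delta>_vertex by (simp add: incl_path_elem d0_def)
  next
    fix a assume "a \<in> arcs Q"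
    then show "\<delta> (incl (Q.arrow a)) = dP (Q.arrow a)"
      using bspec[OF \<delta>_arrow, of "Inl a"] by (simp add: incl_path_elem d1_def)
  qed (simp_all add: res_l_def res_r_def X\<^sub>F.derivation_mult[OF \<delta>] dP_mult)
  have "\<delta> f = \<zero>\<^bsub>X\<^esub>" if f: "f \<in> J" for f
  proof (rule leibniz_vanishes_on_J[OF X\<^sub>F.algebra_bimodule_axioms \<delta> _ _ f])
    fix g x assume g: "g \<in> J" and x: "x \<in> carrier X"
    have "\<pi>\<^sub>F g = \<zero>\<^bsub>B\<^sub>F\<^esub>"
      using g B\<^sub>F.coset_eq_submodule_iff by (simp add: \<pi>\<^sub>F_def algebra_F_def quotient_simps(4))
    then show "l' g x = \<zero>\<^bsub>X\<^esub> \<and> r' x g = \<zero>\<^bsub>X\<^esub>"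
      using x by (simp add: l'_def r'_def res_l_def res_r_def)
  next
    fix g assume g: "g \<in> I"
    have "\<pi> g = \<zero>\<^bsub>B\<^esub>"
      using g B.coset_eq_submodule_iff by (simp add: \<pi>_def bound_quiver_algebra_def quotient_simps(4))
    then show "\<delta> (incl g) = \<zero>\<^bsub>X\<^esub>" using g by (simp add: \<delta>_incl dP_def)
  qed
  \<comment> \<open>so \<open>\<delta>\<close> factors through \<open>B\<^sub>F\<close>\<close>
  then obtain \<eta> where \<eta>: "linear_map K B\<^sub>F X \<eta>" and \<eta>_coset: "\<And>f. f \<in> carrier ?P\<^sub>F \<Longrightarrow> \<eta> (\<pi>\<^sub>F f) = \<delta> f"
    using B\<^sub>F.ex_linear_map_quotient[OF \<delta>.linear_map_axioms] unfolding algebra_F_def \<pi>\<^sub>F_def by blast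
  have surj: "\<exists>f\<in>carrier ?P\<^sub>F. C = \<pi>\<^sub>F f" if "C \<in> carrier B\<^sub>F" for C
    using that unfolding \<pi>\<^sub>F_def algebra_F_def by (auto elim: B\<^sub>F.cosetE)
  have "\<eta> (C \<otimes>\<^bsub>B\<^sub>F\<^esub> D) = r (\<eta> C) D \<oplus>\<^bsub>X\<^esub> l C (\<eta> D)" if C: "C \<in> carrier B\<^sub>F" and D: "D \<in> carrier B\<^sub>F" for C D
  proof -
    obtain f g where fg: "f \<in> carrier ?P\<^sub>F" "C = \<pi>\<^sub>F f" "g \<in> carrier ?P\<^sub>F" "D = \<pi>\<^sub>F g"
      using surj[OF C] surj[OF D] by blast
    then have "\<eta> (C \<otimes>\<^bsub>B\<^sub>F\<^esub> D) = \<delta> (f \<otimes>\<^bsub>?P\<^sub>F\<^esub> g)" by (simp flip: \<eta>_coset)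
    then show ?thesis
      using fg by (simp add: X\<^sub>F.derivation_mult[OF \<delta>] \<eta>_coset l'_def r'_def res_l_def res_r_def)
  qed
  then have "restrict \<eta> (carrier B\<^sub>F) \<in> derivations K B\<^sub>F X l r"
    by (intro X.derivationI \<eta>)
  moreover have "\<eta> (j b) = d b" if b: "b \<in> carrier B" for b
  proof -
    obtain f where f: "f \<in> carrier ?P" "b = \<pi> f"
      using b unfolding \<pi>_def bound_quiver_algebra_def by (auto elim: B.cosetE)
    then show ?thesis by (simp add: j_\<pi> \<eta>_coset \<delta>_incl dP_def)
  qed
  ultimately show ?thesis by (intro bexI) simp_all
qed

end

section \<open>The exact sequence for a bound quiver algebra\<close>

theorem theorem3p6:
  fixes K :: "('k, 'm) ring_scheme"
    and Q :: "('v, 'a) pre_digraph"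
    and I :: "(('v, 'a) path \<Rightarrow> 'k) set"
    and F :: "'f set" and s t :: "'f \<Rightarrow> 'v"
    and X :: "('k, 'x, 'p) module_scheme"
    and l :: "(('v, 'a + 'f) path \<Rightarrow> 'k) set \<Rightarrow> 'x \<Rightarrow> 'x"
    and r :: "'x \<Rightarrow> (('v, 'a + 'f) path \<Rightarrow> 'k) set \<Rightarrow> 'x"
  defines "B \<equiv> bound_quiver_algebra K Q I"
    and "B\<^sub>F \<equiv> algebra_F K Q I F s t"
    and "j \<equiv> canonical_map K Q I F s t"
  assumes "field K"
    and "fin_digraph Q"
    and "admissible_ideal K Q I"
    and "new_arrows Q F s t"
    and "\<nexists>\<gamma>. relative_cycle K Q I F s t \<gamma>"
    and "bimodule K B\<^sub>F X l r"
  shows "short_exact K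
      (relative_HH1 K B\<^sub>F (j ` carrier B) X l r)
      (HH1 K B\<^sub>F X l r)
      (HH1 K B X (res_l j l) (res_r j r))
      (iota K B\<^sub>F X l r)
      (kappa K B j X l r)"
proof -
  interpret K: field K by fact
  interpret bound_quiver_with_new_arrows K Q F s t I
    using assms(5-7)
    by (intro bound_quiver_with_new_arrows.intro quiver_with_new_arrows.intro quiver_algebra.intro
        K.cring_axioms) (simp_all add: admissible_ideal_def)
  show ?thesis
    unfolding B_def B\<^sub>F_def j_def
    using assms(9)[unfolded B\<^sub>F_def] algebra_hom_canonical_map derivation_extends
    by (intro short_exact_if_derivations_extend)
qed

end
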